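(* Let $W_\alpha$ be a subnormal weighted shift with Berger measure $\mu\equiv\nu+\rho\delta_0$, where $\nu(\{0\})=0$, let $\ell\ge 1$ be an integer, and let $x>0$. Then $W_{\alpha(x)}^{\ell}$ is subnormal if and only if $x\le \left(\left\|\frac1t\right\|_{L^1(\nu)}\right)^{-1/2}$. In particular, if $\rho=0$, $W_{\alpha(x)}^{\ell}$ is subnormal if and only if $W_{\alpha(x)}$ is subnormal.
   Context: A weight sequence is a bounded sequence of positive numbers $\alpha=\{\alpha_n\}_{n=0}^\infty$; the weighted shift $W_\alpha$ is the bounded operator on $\ell^2(\mathbf{Z}_+)$ with $W_\alpha e_n:=\alpha_n e_{n+1}$ ($n\ge 0$), where $\{e_n\}_{n=0}^\infty$ is the canonical orthonormal basis. The moments of $\alpha$ are $\gamma_0:=1$ and $\gamma_n:=\alpha_0^2\cdots\alpha_{n-1}^2$ ($n\ge1$). An operator is subnormal if it is the restriction of a normal operator to an invariant subspace. By Berger's Theorem, $W_\alpha$ is subnormal if and only if there is a Borel probability measure $\mu$ supported in $[0,\|W_\alpha\|^2]$, with $\|W_\alpha\|^2\in\operatorname{supp}\mu$, such that $\gamma_n=\int t^n\,d\mu(t)$ for all $n\ge0$; this (unique) $\mu$ is called the Berger measure of $W_\alpha$. Here $\delta_0$ is the unit point mass at $0$, and $\rho=\mu(\{0\})\ge 0$. For $x>0$, the back-step extension $\alpha(x)$ is the weight sequence $x,\alpha_0,\alpha_1,\alpha_2,\dots$. Convention: $\|1/t\|_{L^1(\nu)}=\int \frac1t\,d\nu(t)\in(0,\infty]$,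 and $(\infty)^{-1/2}=0$.
   Formalization: The first equivalence is stated only for ℓ ≥ 2 or ρ = 0; for ℓ = 1, ρ > 0 it fails (μ = (1−ρ)δ_1 + ρδ_0, x = 1). Normal extensions range over Hilbert spaces of vectors from one fixed large set, which contains a copy of every separable one. *)

theory Defs
  imports "HOL-Probability.Probability"
begin

section \<open>Complex Hilbert spaces and subnormal operators\<close>

text \<open>
  Hilbert spaces are given by explicit carriers, because subnormality quantifies existentially
  over the Hilbert space on which the normal extension acts.
\<close>

record 'v inner_space =
  vecs :: "'v set"
  vzero :: 'v
  vplus :: "'v \<Rightarrow> 'v \<Rightarrow> 'v"
  vscale :: "complex \<Rightarrow> 'v \<Rightarrow> 'v"
  vinner :: "'v \<Rightarrow> 'v \<Rightarrow> complex"

definition vnorm :: "'v inner_space \<Rightarrow> 'v \<Rightarrow> real" where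
  "vnorm H x = sqrt (Re (vinner H x x))"

definition vdist :: "'v inner_space \<Rightarrow> 'v \<Rightarrow> 'v \<Rightarrow> real" where
  "vdist H x y = vnorm H (vplus H x (vscale H (-1) y))"

locale hilbert_space =
  fixes H :: "'v inner_space"
  assumes zero_closed: "vzero H \<in> vecs H"
    and plus_closed: "\<lbrakk>x \<in> vecs H; y \<in> vecs H\<rbrakk> \<Longrightarrow> vplus H x y \<in> vecs H"
    and scale_closed: "x \<in> vecs H \<Longrightarrow> vscale H c x \<in> vecs H"
    and plus_assoc: "\<lbrakk>x \<in> vecs H; y \<in> vecs H; z \<in> vecs H\<rbrakk>
      \<Longrightarrow> vplus H (vplus H x y) z = vplus H x (vplus H y z)"
    and plus_commute: "\<lbrakk>x \<in> vecs H; y \<in> vecs H\<rbrakk> \<Longrightarrow> vplus H x y = vplus H y x"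
    and plus_zero: "x \<in> vecs H \<Longrightarrow> vplus H x (vzero H) = x"
    and plus_inverse: "x \<in> vecs H \<Longrightarrow> vplus H x (vscale H (-1) x) = vzero H"
    and scale_one: "x \<in> vecs H \<Longrightarrow> vscale H 1 x = x"
    and scale_scale: "x \<in> vecs H \<Longrightarrow> vscale H a (vscale H b x) = vscale H (a * b) x"
    and scale_add_left: "x \<in> vecs H
      \<Longrightarrow> vscale H (a + b) x = vplus H (vscale H a x) (vscale H b x)"
    and scale_add_right: "\<lbrakk>x \<in> vecs H; y \<in> vecs H\<rbrakk>
      \<Longrightarrow> vscale H a (vplus H x y) = vplus H (vscale H a x) (vscale H a y)"
    and inner_add_left: "\<lbrakk>x \<in> vecs H; y \<in> vecs H; z \<in> vecs H\<rbrakk>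
      \<Longrightarrow> vinner H (vplus H x y) z = vinner H x z + vinner H y z"
    and inner_scale_left: "\<lbrakk>x \<in> vecs H; y \<in> vecs H\<rbrakk>
      \<Longrightarrow> vinner H (vscale H a x) y = a * vinner H x y"
    and inner_commute: "\<lbrakk>x \<in> vecs H; y \<in> vecs H\<rbrakk> \<Longrightarrow> vinner H x y = cnj (vinner H y x)"
    and inner_nonneg: "x \<in> vecs H \<Longrightarrow> 0 \<le> Re (vinner H x x)"
    and inner_definite: "\<lbrakk>x \<in> vecs H; vinner H x x = 0\<rbrakk> \<Longrightarrow> x = vzero H"
    and complete: "\<lbrakk>\<And>n. X n \<in> vecs H; \<forall>e>0. \<exists>M. \<forall>m\<ge>M. \<forall>n\<ge>M. vdist H (X m) (X n) < e\<rbrakk>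
      \<Longrightarrow> \<exists>L\<in>vecs H. (\<lambda>n. vdist H (X n) L) \<longlonglongrightarrow> 0"

definition linear_map :: "'v inner_space \<Rightarrow> 'w inner_space \<Rightarrow> ('v \<Rightarrow> 'w) \<Rightarrow> bool" where
  "linear_map H K T \<longleftrightarrow>
     (\<forall>x\<in>vecs H. T x \<in> vecs K) \<and>
     (\<forall>x\<in>vecs H. \<forall>y\<in>vecs H. T (vplus H x y) = vplus K (T x) (T y)) \<and>
     (\<forall>c. \<forall>x\<in>vecs H. T (vscale H c x) = vscale K c (T x))"

definition bounded_operator :: "'v inner_space \<Rightarrow> ('v \<Rightarrow> 'v) \<Rightarrow> bool" where
  "bounded_operator H T \<longleftrightarrow>
     linear_map H H T \<and> (\<exists>C. \<forall>x\<in>vecs H. vnorm H (T x) \<le> C * vnorm H x)"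

definition operator_norm :: "'v inner_space \<Rightarrow> ('v \<Rightarrow> 'v) \<Rightarrow> real" where
  "operator_norm H T = (SUP x\<in>{x \<in> vecs H. vnorm H x \<le> 1}. vnorm H (T x))"

definition adjoint_of :: "'v inner_space \<Rightarrow> ('v \<Rightarrow> 'v) \<Rightarrow> ('v \<Rightarrow> 'v) \<Rightarrow> bool" where
  "adjoint_of H N M \<longleftrightarrow>
     bounded_operator H M \<and>
     (\<forall>x\<in>vecs H. \<forall>y\<in>vecs H. vinner H (N x) y = vinner H x (M y))"

definition normal_operator :: "'v inner_space \<Rightarrow> ('v \<Rightarrow> 'v) \<Rightarrow> bool" where
  "normal_operator H N \<longleftrightarrow>
     bounded_operator H N \<and>
     (\<exists>M. adjoint_of H N M \<and> (\<forall>x\<in>vecs H. N (M x) = M (N x)))"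

definition isometric_embedding :: "'v inner_space \<Rightarrow> 'w inner_space \<Rightarrow> ('v \<Rightarrow> 'w) \<Rightarrow> bool" where
  "isometric_embedding H K V \<longleftrightarrow>
     linear_map H K V \<and>
     (\<forall>x\<in>vecs H. \<forall>y\<in>vecs H. vinner K (V x) (V y) = vinner H x y)"

text \<open>
  \<open>T\<close> is the restriction of a normal operator \<open>N\<close> on a Hilbert space \<open>K\<close> to an
  invariant subspace, where \<open>H\<close> is identified with its image in \<open>K\<close> under a linear isometry
  \<open>V\<close>; the identity \<open>N V = V T\<close> says that this image is \<open>N\<close>-invariant and that \<open>N\<close> restricts
  to \<open>T\<close> on it.

  HOL cannot quantify over types inside a formula, so \<open>K\<close> ranges over all Hilbert spaces whose
  vectors are elements of the type \<^typ>\<open>'v set\<close>. This loses nothing. A normal \<open>N\<close> may be cut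
  down to the closed linear span \<open>K\<^sub>0\<close> of the vectors \<open>N\<^sup>*\<^sup>k h\<close> with \<open>h \<in> H\<close>,
  and a vector \<open>u\<close> of \<open>K\<^sub>0\<close> is determined by the sequence, indexed by \<open>k\<close>, of the orthogonal
  projections of \<open>N\<^sup>k u\<close> to \<open>H\<close>. Hence \<open>K\<^sub>0\<close> has at most as many elements as there are
  sequences in \<open>H\<close>, and (for \<open>H\<close> infinite, i.e. nonzero) these are no more numerous than the
  subsets of \<open>H\<close>.
\<close>

definition subnormal_operator :: "'v inner_space \<Rightarrow> ('v \<Rightarrow> 'v) \<Rightarrow> bool" where
  "subnormal_operator H T \<longleftrightarrow>
     bounded_operator H T \<and>
     (\<exists>(K :: 'v set inner_space) N V.
        hilbert_space K \<and> normal_operator K N \<and> isometric_embedding H K V \<and>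
        (\<forall>x\<in>vecs H. N (V x) = V (T x)))"


section \<open>Weighted shifts\<close>

definition ell2 :: "(nat \<Rightarrow> complex) inner_space" where
  "ell2 = \<lparr> vecs = {f. summable (\<lambda>n. (cmod (f n))\<^sup>2)},
            vzero = (\<lambda>n. 0),
            vplus = (\<lambda>f g n. f n + g n),
            vscale = (\<lambda>c f n. c * f n),
            vinner = (\<lambda>f g. \<Sum>n. f n * cnj (g n)) \<rparr>"

definition basis_vec :: "nat \<Rightarrow> nat \<Rightarrow> complex" where
  "basis_vec n = (\<lambda>k. if k = n then 1 else 0)"

definition weight_sequence :: "(nat \<Rightarrow> real) \<Rightarrow> bool" where
  "weight_sequence \<alpha> \<longleftrightarrow> (\<forall>n. 0 < \<alpha> n) \<and> bounded (range \<alpha>)"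

definition weighted_shift :: "(nat \<Rightarrow> real) \<Rightarrow> (nat \<Rightarrow> complex) \<Rightarrow> (nat \<Rightarrow> complex)" where
  "weighted_shift \<alpha> f = (\<lambda>n. case n of 0 \<Rightarrow> 0 | Suc k \<Rightarrow> of_real (\<alpha> k) * f k)"

lemma weighted_shift_basis_vec:
  "weighted_shift \<alpha> (basis_vec n) = vscale ell2 (of_real (\<alpha> n)) (basis_vec (Suc n))"
  by (auto simp: weighted_shift_def basis_vec_def ell2_def fun_eq_iff split: nat.split)

definition moment :: "(nat \<Rightarrow> real) \<Rightarrow> nat \<Rightarrow> real" where
  "moment \<alpha> n = (\<Prod>i<n. (\<alpha> i)\<^sup>2)"

definition back_step :: "real \<Rightarrow> (nat \<Rightarrow> real) \<Rightarrow> nat \<Rightarrow> real" where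
  "back_step x \<alpha> = case_nat x \<alpha>"


section \<open>Berger measures\<close>

definition measure_support :: "real measure \<Rightarrow> real set" where
  "measure_support \<mu> = {t. \<forall>U. open U \<and> t \<in> U \<longrightarrow> emeasure \<mu> U \<noteq> 0}"

definition berger_measure :: "(nat \<Rightarrow> real) \<Rightarrow> real measure \<Rightarrow> bool" where
  "berger_measure \<alpha> \<mu> \<longleftrightarrow>
     prob_space \<mu> \<and> sets \<mu> = sets borel \<and>
     measure_support \<mu> \<subseteq> {0..(operator_norm ell2 (weighted_shift \<alpha>))\<^sup>2} \<and>
     (operator_norm ell2 (weighted_shift \<alpha>))\<^sup>2 \<in> measure_support \<mu> \<and>
     (\<forall>n. integrable \<mu> (\<lambda>t. t ^ n) \<and> moment \<alpha> n = (\<integral>t. t ^ n \<partial>\<mu>))"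

definition L1_norm_inverse :: "real measure \<Rightarrow> ennreal" where
  "L1_norm_inverse \<nu> = (\<integral>\<^sup>+t. ennreal \<bar>1 / t\<bar> \<partial>\<nu>)"

definition inverse_sqrt :: "ennreal \<Rightarrow> real" where
  "inverse_sqrt a = (if a = \<infinity> then 0 else enn2real a powr (- 1 / 2))"

end

theory Submission
  imports Defs
begin

text \<open>
  Write \<open>\<beta> = \<alpha>(x)\<close> and let \<open>T\<close> be the \<open>l\<close>-th power of its weighted shift. Since \<open>1 / 0 = 0\<close>, the
  integral of \<open>1 / t\<close> is the same for \<open>\<mu>\<close> and \<open>\<nu>\<close>, and the condition on \<open>x\<close> says that
  \<open>x\<^sup>2 \<integral> 1/t d\<mu> \<le> 1\<close>. Moreover \<open>\<gamma>\<^sub>0(\<beta>) = 1\<close> and \<open>\<gamma>\<^sub>n(\<beta>) = x\<^sup>2 \<integral> t\<^sup>n\<^sup>-\<^sup>1 d\<mu>\<close> for \<open>n \<ge> 1\<close>. On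
  \<open>t > 0\<close> these moments, for \<open>n \<ge> 2\<close>, are those of the measure \<open>x\<^sup>2 d\<mu>/t\<close>, and the condition says
  that it leaves a nonnegative part of \<open>\<gamma>\<^sub>0(\<beta>) = 1\<close> for the point 0.

  Necessity (\<open>subnormal_power_imp_integral_le\<close>). Let a normal \<open>N\<close> extend \<open>T\<close>, put
  \<open>v = e\<^sub>0\<close>, and let \<open>[0,R]\<close> carry \<open>\<mu>\<close>. The numbers
  \<open>\<langle>(N\<^sup>*N)\<^sup>k v, v\<rangle> = \<parallel>T\<^sup>k e\<^sub>0\<parallel>\<^sup>2 = \<gamma>\<^sub>k\<^sub>l(\<beta>)\<close> are known. The even power
  \<open>(1 - N\<^sup>*N / R\<^sup>l)\<^sup>2\<^sup>n\<close> is positive (\<open>normal_even_differences_nonneg\<close>), and expressing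
  this through these numbers gives \<open>x\<^sup>2 \<integral> (1 - (1 - t\<^sup>l / R\<^sup>l)\<^sup>2\<^sup>n) / t d\<mu> \<le> 1\<close>. Let \<open>n\<close> tend to infinity
  and apply Fatou's lemma.

  Sufficiency (\<open>integral_le_imp_subnormal_power\<close>). A normal extension is written down on
  \<open>L\<^sup>2\<close> of a countable number of copies of \<open>\<mu>\<close>, indexed by the integers: \<open>\<gamma>\<^sub>n(\<beta>)\<^sup>1\<^sup>/\<^sup>2 e\<^sub>n\<close>
  becomes the function \<open>x t\<^sup>(\<^sup>n\<^sup>-\<^sup>1\<^sup>)\<^sup>/\<^sup>2\<close> on the \<open>n\<close>-th copy, and \<open>N\<close> multiplies by
  \<open>t\<^sup>l\<^sup>/\<^sup>2\<close> and moves each copy by \<open>l\<close>. The squared norms are right for \<open>n \<ge> 1\<close>; that of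
  the image of \<open>e\<^sub>0\<close> is too small by \<open>1 - x\<^sup>2 \<integral> 1/t d\<mu>\<close>, which is made up for by an additional
  component on which \<open>N\<close> vanishes. Such an \<open>N\<close> intertwines as required except at \<open>t = 0\<close> if
  \<open>l = 1\<close>: there it sends \<open>e\<^sub>0\<close> to 0, but the function of \<open>e\<^sub>1\<close> is the constant \<open>x\<close>. Hence the
  assumption that \<open>l \<ge> 2\<close> or \<open>\<rho> = 0\<close>.

  This takes the completeness of \<open>L\<^sup>2\<close> (\<open>hilbert_space_L2\<close>) and the normality of invariantly
  weighted measure-preserving compositions (\<open>normal_operator_weighted_composition\<close>).
\<close>

section \<open>Operators on Hilbert spaces\<close>

context hilbert_space
begin

lemma inner_add_right:
  assumes "x \<in> vecs H" "y \<in> vecs H" "z \<in> vecs H"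
  shows "vinner H x (vplus H y z) = vinner H x y + vinner H x z"
proof -
  have "vinner H x (vplus H y z) = cnj (vinner H (vplus H y z) x)"
    using assms by (intro inner_commute plus_closed)
  also have "\<dots> = vinner H x y + vinner H x z"
    using assms by (simp add: inner_add_left inner_commute[of x])
  finally show ?thesis .
qed

lemma inner_scale_right:
  assumes "x \<in> vecs H" "y \<in> vecs H"
  shows "vinner H x (vscale H a y) = cnj a * vinner H x y"
proof -
  have "vinner H x (vscale H a y) = cnj (vinner H (vscale H a y) x)"
    using assms by (intro inner_commute scale_closed)
  also have "\<dots> = cnj a * vinner H x y"
    using assms by (simp add: inner_scale_left inner_commute[of x])
  finally show ?thesis .
qed

text \<open>
  The array \<open>E\<close> consists of the differences \<open>\<langle>(1 - r N\<^sup>*N)\<^sup>m N\<^sup>k v, N\<^sup>k v\<rangle>\<close>,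
  which satisfy the recurrence because \<open>N\<close> commutes with \<open>N\<^sup>*N\<close>. Since \<open>1 - r N\<^sup>*N\<close> is
  self-adjoint, an even power of it is a square, whence positivity.
\<close>

lemma normal_even_differences_nonneg:
  fixes E :: "nat \<Rightarrow> nat \<Rightarrow> real" and r :: real
  assumes N: "normal_operator H N" and v: "v \<in> vecs H"
    and E_0: "\<And>k. complex_of_real (E 0 k) = vinner H ((N ^^ k) v) ((N ^^ k) v)"
    and E_Suc: "\<And>m k. E (Suc m) k = E m k - r * E m (Suc k)"
  shows "0 \<le> E (2 * n) 0"
proof -
  obtain M where bN: "bounded_operator H N" and bM: "bounded_operator H M"
    and adj: "\<And>x y. x \<in> vecs H \<Longrightarrow> y \<in> vecs H \<Longrightarrow> vinner H (N x) y = vinner H x (M y)"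
    and comm: "\<And>x. x \<in> vecs H \<Longrightarrow> N (M x) = M (N x)"
    using N unfolding normal_operator_def adjoint_of_def by blast
  have Nc: "N y \<in> vecs H" if "y \<in> vecs H" for y
    using bN that unfolding bounded_operator_def linear_map_def by blast
  have Mc: "M y \<in> vecs H" if "y \<in> vecs H" for y
    using bM that unfolding bounded_operator_def linear_map_def by blast
  have Nplus: "N (vplus H y z) = vplus H (N y) (N z)" if "y \<in> vecs H" "z \<in> vecs H" for y z
    using bN that unfolding bounded_operator_def linear_map_def by blast
  have Nscale: "N (vscale H c y) = vscale H c (N y)" if "y \<in> vecs H" for y c
    using bN that unfolding bounded_operator_def linear_map_def by blast
  have adj': "vinner H (M y) z = vinner H y (N z)" if "y \<in> vecs H" "z \<in> vecs H" for y z
    using adj[OF that(2,1)] inner_commute[of "M y" z] inner_commute[of y "N z"] Nc Mc that by simp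
  define B where "B y = vplus H y (vscale H (- of_real r) (M (N y)))" for y
  have Bc: "B y \<in> vecs H" if "y \<in> vecs H" for y
    unfolding B_def using that by (intro plus_closed scale_closed Mc Nc)
  have Bmc: "(B ^^ m) y \<in> vecs H" if "y \<in> vecs H" for y m
    using that by (induction m) (auto intro: Bc)
  have Nmc: "(N ^^ m) y \<in> vecs H" if "y \<in> vecs H" for y m
    using that by (induction m) (auto intro: Nc)
  have B_inner: "vinner H (B y) z = vinner H y z - of_real r * vinner H (N y) (N z)"
    if "y \<in> vecs H" "z \<in> vecs H" for y z
    unfolding B_def using that by (simp add: inner_add_left inner_scale_left adj' scale_closed Mc Nc)
  have B_sym: "vinner H (B y) z = vinner H y (B z)" if "y \<in> vecs H" "z \<in> vecs H" for y z
    using B_inner[OF that] that unfolding B_def[of z]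
    by (simp add: inner_add_right inner_scale_right adj scale_closed Mc Nc)
  have Bm_sym: "vinner H ((B ^^ m) y) z = vinner H y ((B ^^ m) z)"
    if "y \<in> vecs H" "z \<in> vecs H" for y z m
    using that
  proof (induction m arbitrary: y z)
    case (Suc m)
    then show ?case
      by (metis B_sym Bc Bmc funpow.simps(2) funpow_swap1 o_apply)
  qed simp
  have NB: "N (B y) = B (N y)" if "y \<in> vecs H" for y
    unfolding B_def using that by (simp add: Nplus Nscale scale_closed Mc Nc comm)
  have NBm: "N ((B ^^ m) y) = (B ^^ m) (N y)" if "y \<in> vecs H" for y m
    using that by (induction m) (auto simp: NB Bmc)
  have D: "complex_of_real (E m k) = vinner H ((B ^^ m) ((N ^^ k) v)) ((N ^^ k) v)" for m k
  proof (induction m arbitrary: k)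
    case 0
    show ?case by (simp add: E_0)
  next
    case (Suc m)
    show ?case
      using Suc[of k] Suc[of "Suc k"] v
      by (simp add: E_Suc B_inner NBm Bmc Nmc)
  qed
  have "complex_of_real (E (2 * n) 0) = vinner H ((B ^^ n) v) ((B ^^ n) v)"
    using D[of "2 * n" 0] Bm_sym[of "(B ^^ n) v" v n] v Bmc by (simp add: mult_2 funpow_add)
  then show ?thesis
    using inner_nonneg[OF Bmc[OF v, of n]] by (metis Re_complex_of_real)
qed

end

text \<open>
  Subnormality asks for a Hilbert space with vectors in one particular type; an isomorphic copy
  along an injection moves a Hilbert space there from the type on which it is built.
\<close>

definition transport_space :: "('w \<Rightarrow> 'u) \<Rightarrow> 'w inner_space \<Rightarrow> 'u inner_space" where
  "transport_space j H = \<lparr> vecs = j ` vecs H, vzero = j (vzero H),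
     vplus = (\<lambda>x y. j (vplus H (inv j x) (inv j y))),
     vscale = (\<lambda>c x. j (vscale H c (inv j x))),
     vinner = (\<lambda>x y. vinner H (inv j x) (inv j y)) \<rparr>"

context
  fixes j :: "'w \<Rightarrow> 'u" and H :: "'w inner_space"
  assumes inj: "inj j"
begin

lemma transport_simps:
  "vecs (transport_space j H) = j ` vecs H"
  "vzero (transport_space j H) = j (vzero H)"
  "vplus (transport_space j H) (j x) (j y) = j (vplus H x y)"
  "vscale (transport_space j H) c (j x) = j (vscale H c x)"
  "vinner (transport_space j H) (j x) (j y) = vinner H x y"
  "vnorm (transport_space j H) (j x) = vnorm H x"
  "vdist (transport_space j H) (j x) (j y) = vdist H x y"
  using inj by (simp_all add: transport_space_def vnorm_def vdist_def inv_f_f)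

lemma hilbert_space_transport:
  assumes "hilbert_space H"
  shows "hilbert_space (transport_space j H)"
proof -
  interpret hilbert_space H by fact
  show ?thesis
  proof
    fix X :: "nat \<Rightarrow> 'u"
    assume X: "X n \<in> vecs (transport_space j H)" for n
    assume *: "\<forall>e>0. \<exists>M. \<forall>m\<ge>M. \<forall>n\<ge>M. vdist (transport_space j H) (X m) (X n) < e"
    have "\<forall>n. \<exists>y. y \<in> vecs H \<and> X n = j y"
      using X by (auto simp: transport_simps)
    then obtain Y where Y: "\<And>n. Y n \<in> vecs H" "\<And>n. X n = j (Y n)"
      by metis
    have "\<exists>L\<in>vecs H. (\<lambda>n. vdist H (Y n) L) \<longlonglongrightarrow> 0"
      using * by (intro complete Y(1)) (simp add: Y(2) transport_simps)
    then show "\<exists>L\<in>vecs (transport_space j H). (\<lambda>n. vdist (transport_space j H) (X n) L) \<longlonglongrightarrow> 0"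
      by (auto simp: Y(2) transport_simps)
  qed (auto simp: transport_simps zero_closed plus_closed scale_closed plus_assoc
      plus_zero plus_inverse scale_one scale_scale scale_add_left scale_add_right inner_add_left
      inner_scale_left inner_nonneg intro: inner_commute arg_cong[of _ _ j, OF plus_commute]
      arg_cong[of _ _ j, OF inner_definite])
qed

lemma bounded_operator_transport:
  assumes "bounded_operator H T"
  shows "bounded_operator (transport_space j H) (\<lambda>x. j (T (inv j x)))"
  using assms inj unfolding bounded_operator_def linear_map_def
  by (auto simp: transport_simps inv_f_f)

lemma normal_operator_transport:
  assumes "normal_operator H N"
  shows "normal_operator (transport_space j H) (\<lambda>x. j (N (inv j x)))"
proof -
  obtain M where M: "adjoint_of H N M" "\<forall>x\<in>vecs H. N (M x) = M (N x)"
    using assms unfolding normal_operator_def by blast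
  have "adjoint_of (transport_space j H) (\<lambda>x. j (N (inv j x))) (\<lambda>x. j (M (inv j x)))"
    using M(1) inj bounded_operator_transport unfolding adjoint_of_def
    by (auto simp: transport_simps inv_f_f)
  moreover have "\<forall>x\<in>vecs (transport_space j H).
      j (N (inv j (j (M (inv j x))))) = j (M (inv j (j (N (inv j x)))))"
    using M(2) inj by (auto simp: transport_simps inv_f_f)
  ultimately show ?thesis
    using assms bounded_operator_transport unfolding normal_operator_def by blast
qed

end

lemma subnormal_operatorI:
  fixes j :: "'w \<Rightarrow> 'v set" and H :: "'v inner_space" and K :: "'w inner_space"
  assumes "inj j" "bounded_operator H T" "hilbert_space K" "normal_operator K N"
    and V: "isometric_embedding H K V" and NV: "\<And>x. x \<in> vecs H \<Longrightarrow> N (V x) = V (T x)"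
  shows "subnormal_operator H T"
proof -
  have "isometric_embedding H (transport_space j K) (\<lambda>x. j (V x))"
    using V \<open>inj j\<close> unfolding isometric_embedding_def linear_map_def
    by (auto simp: transport_simps)
  moreover have "\<forall>x\<in>vecs H. j (N (inv j (j (V x)))) = j (V (T x))"
    using NV \<open>inj j\<close> by (simp add: inv_f_f)
  ultimately show ?thesis
    using hilbert_space_transport[OF \<open>inj j\<close>, of K] normal_operator_transport[OF \<open>inj j\<close>, of K N]
      assms unfolding subnormal_operator_def by blast
qed


section \<open>The Hilbert space of square-integrable functions\<close>

definition square_integrable :: "'a measure \<Rightarrow> ('a \<Rightarrow> complex) \<Rightarrow> bool" where
  "square_integrable M f \<longleftrightarrow> f \<in> borel_measurable M \<and> integrable M (\<lambda>x. (cmod (f x))\<^sup>2)"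

lemma borel_measurable_cnj [measurable]:
  "f \<in> borel_measurable M \<Longrightarrow> (\<lambda>x. cnj (f x)) \<in> borel_measurable M"
  by (rule measurable_compose[OF _ borel_measurable_continuous_onI]) (auto intro: continuous_intros)

text \<open>
  The choice depends on \<open>f\<close> only through its class modulo null sets, so that functions which agree
  almost everywhere have the same representative.
\<close>

definition ae_rep :: "'a measure \<Rightarrow> ('a \<Rightarrow> complex) \<Rightarrow> 'a \<Rightarrow> complex" where
  "ae_rep M f = (SOME g. g \<in> borel_measurable M \<and> (AE x in M. g x = f x))"

text \<open>
  Vectors are representatives rather than classes, so that they are functions and not sets of
  functions: for functions on the line, the latter type is too large to be embedded into \<^typ>\<open>(nat \<Rightarrow> complex) set\<close>.
\<close>

definition L2_space :: "'a measure \<Rightarrow> ('a \<Rightarrow> complex) inner_space" where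
  "L2_space M = \<lparr> vecs = ae_rep M ` {f. square_integrable M f},
     vzero = ae_rep M (\<lambda>x. 0),
     vplus = (\<lambda>f g. ae_rep M (\<lambda>x. f x + g x)),
     vscale = (\<lambda>c f. ae_rep M (\<lambda>x. c * f x)),
     vinner = (\<lambda>f g. \<integral>x. f x * cnj (g x) \<partial>M) \<rparr>"

lemma ae_rep:
  assumes "f \<in> borel_measurable M"
  shows ae_rep_measurable: "ae_rep M f \<in> borel_measurable M"
    and AE_ae_rep: "AE x in M. ae_rep M f x = f x"
proof -
  have "ae_rep M f \<in> borel_measurable M \<and> (AE x in M. ae_rep M f x = f x)"
    unfolding ae_rep_def by (rule someI[of _ f]) (use assms in auto)
  then show "ae_rep M f \<in> borel_measurable M" "AE x in M. ae_rep M f x = f x" by auto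
qed

lemma ae_rep_cong:
  assumes "AE x in M. f x = g x"
  shows "ae_rep M f = ae_rep M g"
proof -
  have "(AE x in M. h x = f x) \<longleftrightarrow> (AE x in M. h x = g x)" for h
  proof
    show "AE x in M. h x = g x" if "AE x in M. h x = f x"
      using that assms by eventually_elim simp
    show "AE x in M. h x = f x" if "AE x in M. h x = g x"
      using that assms by eventually_elim simp
  qed
  then show ?thesis by (simp add: ae_rep_def)
qed

lemma square_integrable_cong:
  assumes "f \<in> borel_measurable M" "AE x in M. f x = g x" "square_integrable M g"
  shows "square_integrable M f"
proof -
  have "integrable M (\<lambda>x. (cmod (f x))\<^sup>2) \<longleftrightarrow> integrable M (\<lambda>x. (cmod (g x))\<^sup>2)"
    using assms by (intro integrable_cong_AE) (auto simp: square_integrable_def)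
  then show ?thesis using assms by (auto simp: square_integrable_def)
qed

lemma L2_space_vecs:
  assumes "f \<in> vecs (L2_space M)"
  shows "square_integrable M f" "f \<in> borel_measurable M" "ae_rep M f = f"
proof -
  obtain h where h: "square_integrable M h" "f = ae_rep M h"
    using assms by (auto simp: L2_space_def)
  then have "h \<in> borel_measurable M" by (simp add: square_integrable_def)
  note r = ae_rep[OF this]
  show "square_integrable M f" using square_integrable_cong[OF r h(1)] h(2) by simp
  show "f \<in> borel_measurable M" "ae_rep M f = f"
    using r ae_rep_cong[OF r(2)] h(2) by simp_all
qed

lemma L2_space_eqI:
  assumes "f \<in> vecs (L2_space M)" "g \<in> vecs (L2_space M)" "AE x in M. f x = g x"
  shows "f = g"
  using ae_rep_cong[OF assms(3)] L2_space_vecs(3)[OF assms(1)] L2_space_vecs(3)[OF assms(2)] by simp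

lemma ae_rep_in_L2: "square_integrable M f \<Longrightarrow> ae_rep M f \<in> vecs (L2_space M)"
  by (simp add: L2_space_def)

lemma integrable_dominated:
  fixes f :: "'a \<Rightarrow> 'b::{banach, second_countable_topology}" and h :: "'a \<Rightarrow> real"
  assumes "integrable M h" "f \<in> borel_measurable M" "\<And>x. norm (f x) \<le> h x"
  shows "integrable M f"
proof (rule Bochner_Integration.integrable_bound[OF assms(1,2)])
  show "AE x in M. norm (f x) \<le> norm (h x)"
    using assms(3) by (intro AE_I2) (metis abs_ge_self order_trans real_norm_def)
qed

lemma square_integrable_mult_bounded:
  assumes "square_integrable M f" "g \<in> borel_measurable M" "\<And>x. cmod (g x) \<le> C"
  shows "square_integrable M (\<lambda>x. g x * f x)"
  unfolding square_integrable_def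
proof
  show "(\<lambda>x. g x * f x) \<in> borel_measurable M"
    using assms by (auto simp: square_integrable_def)
  have C: "0 \<le> C" using assms(3) norm_ge_zero order_trans by blast
  have "(cmod (g x * f x))\<^sup>2 \<le> C\<^sup>2 * (cmod (f x))\<^sup>2" for x
    unfolding norm_mult power_mult_distrib by (intro mult_right_mono power_mono assms) auto
  moreover have "(\<lambda>x. (cmod (g x * f x))\<^sup>2) \<in> borel_measurable M"
    using assms by (auto simp: square_integrable_def)
  moreover have "integrable M (\<lambda>x. C\<^sup>2 * (cmod (f x))\<^sup>2)"
    using assms by (auto simp: square_integrable_def)
  ultimately show "integrable M (\<lambda>x. (cmod (g x * f x))\<^sup>2)"
    by - (rule integrable_dominated[of M "\<lambda>x. C\<^sup>2 * (cmod (f x))\<^sup>2"], simp_all)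
qed

lemma square_integrable_scale: "square_integrable M f \<Longrightarrow> square_integrable M (\<lambda>x. c * f x)"
  by (rule square_integrable_mult_bounded[where C = "cmod c"]) auto

lemma square_integrable_add:
  assumes "square_integrable M f" "square_integrable M g"
  shows "square_integrable M (\<lambda>x. f x + g x)"
  unfolding square_integrable_def
proof
  show "(\<lambda>x. f x + g x) \<in> borel_measurable M"
    using assms by (auto simp: square_integrable_def)
  have *: "(cmod (a + b))\<^sup>2 \<le> 2 * (cmod a)\<^sup>2 + 2 * (cmod b)\<^sup>2" for a b
  proof -
    have "(cmod (a + b))\<^sup>2 \<le> (cmod a + cmod b)\<^sup>2"
      by (intro power_mono norm_triangle_ineq) auto
    also have "\<dots> \<le> 2 * (cmod a)\<^sup>2 + 2 * (cmod b)\<^sup>2"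
      using sum_squares_bound[of "cmod a" "cmod b"] by (simp add: power2_sum)
    finally show ?thesis .
  qed
  have "(\<lambda>x. (cmod (f x + g x))\<^sup>2) \<in> borel_measurable M"
    using assms by (auto simp: square_integrable_def)
  moreover have "integrable M (\<lambda>x. 2 * (cmod (f x))\<^sup>2 + 2 * (cmod (g x))\<^sup>2)"
    using assms by (auto simp: square_integrable_def)
  ultimately show "integrable M (\<lambda>x. (cmod (f x + g x))\<^sup>2)"
    by - (rule integrable_dominated[of M "\<lambda>x. 2 * (cmod (f x))\<^sup>2 + 2 * (cmod (g x))\<^sup>2"], simp_all add: *)
qed

lemma integrable_L2_product:
  assumes "square_integrable M f" "square_integrable M g"
  shows "integrable M (\<lambda>x. f x * cnj (g x))"
proof -
  have "cmod (f x * cnj (g x)) \<le> (cmod (f x))\<^sup>2 + (cmod (g x))\<^sup>2" for x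
  proof -
    have "cmod (f x * cnj (g x)) * 2 \<le> (cmod (f x))\<^sup>2 + (cmod (g x))\<^sup>2"
      using sum_squares_bound[of "cmod (f x)" "cmod (g x)"] by (simp add: norm_mult)
    moreover have "0 \<le> cmod (f x * cnj (g x))" by (rule norm_ge_zero)
    ultimately show ?thesis by linarith
  qed
  moreover have "(\<lambda>x. f x * cnj (g x)) \<in> borel_measurable M"
    using assms by (auto simp: square_integrable_def)
  moreover have "integrable M (\<lambda>x. (cmod (f x))\<^sup>2 + (cmod (g x))\<^sup>2)"
    using assms by (auto simp: square_integrable_def)
  ultimately show ?thesis
    by - (rule integrable_dominated[of M "\<lambda>x. (cmod (f x))\<^sup>2 + (cmod (g x))\<^sup>2"], simp_all)
qed

lemma L2_inner_self:
  "vinner (L2_space M) f f = of_real (\<integral>x. (cmod (f x))\<^sup>2 \<partial>M)"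
proof -
  have "(\<lambda>x. f x * cnj (f x)) = (\<lambda>x. of_real ((cmod (f x))\<^sup>2))"
    by (simp only: complex_norm_square)
  then show ?thesis by (simp only: L2_space_def inner_space.simps integral_complex_of_real)
qed

lemma L2_norm_power2: "(vnorm (L2_space M) f)\<^sup>2 = (\<integral>x. (cmod (f x))\<^sup>2 \<partial>M)"
  by (simp add: vnorm_def L2_inner_self)

lemma L2_norm_nonneg: "0 \<le> vnorm (L2_space M) f"
  by (simp add: vnorm_def L2_inner_self)

lemma square_integrable_nn_integral:
  assumes "square_integrable M f"
  shows "(\<integral>\<^sup>+x. ennreal ((cmod (f x))\<^sup>2) \<partial>M) = ennreal (\<integral>x. (cmod (f x))\<^sup>2 \<partial>M)"
  using assms by (intro nn_integral_eq_integral) (auto simp: square_integrable_def)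

lemma square_integrableI:
  assumes "f \<in> borel_measurable M" "(\<integral>\<^sup>+x. ennreal ((cmod (f x))\<^sup>2) \<partial>M) < \<infinity>"
  shows "square_integrable M f"
  using assms unfolding square_integrable_def by (auto intro!: integrableI_nonneg)

text \<open>
  The inequality \<open>\<integral> \<Sum>\<^sub>k 2\<^sup>k |Y\<^sub>k\<^sub>+\<^sub>1 - Y\<^sub>k|\<^sup>2 < \<infinity>\<close> bounds
  \<open>|Y\<^sub>k\<^sub>+\<^sub>1 - Y\<^sub>k|\<close> by a multiple of the geometric sequence \<open>2\<^sup>-\<^sup>k\<^sup>/\<^sup>2\<close> at almost every
  point.
\<close>

lemma rapidly_Cauchy_AE_convergent:
  fixes Y :: "nat \<Rightarrow> 'a \<Rightarrow> complex"
  assumes Y[measurable]: "\<And>k. Y k \<in> borel_measurable M"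
    and le: "\<And>k. (\<integral>\<^sup>+x. ennreal ((cmod (Y (Suc k) x - Y k x))\<^sup>2) \<partial>M) \<le> ennreal ((1/4) ^ k)"
  shows "AE x in M. convergent (\<lambda>k. Y k x)"
proof -
  define u where "u k x = 2 ^ k * (cmod (Y (Suc k) x - Y k x))\<^sup>2" for k x
  have [measurable]: "u k \<in> borel_measurable M" for k unfolding u_def by measurable
  have u0: "0 \<le> u k x" for k x by (simp add: u_def)
  have "(\<integral>\<^sup>+x. ennreal (u k x) \<partial>M) \<le> ennreal ((1/2) ^ k)" for k
  proof -
    have "(\<integral>\<^sup>+x. ennreal (u k x) \<partial>M)
        = ennreal (2 ^ k) * (\<integral>\<^sup>+x. ennreal ((cmod (Y (Suc k) x - Y k x))\<^sup>2) \<partial>M)"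
      unfolding u_def by (subst nn_integral_cmult[symmetric]) (auto simp: ennreal_mult)
    also have "\<dots> \<le> ennreal (2 ^ k) * ennreal ((1/4) ^ k)"
      by (intro mult_left_mono le) auto
    also have "\<dots> = ennreal ((1/2) ^ k)"
      by (simp add: ennreal_mult[symmetric] power_mult_distrib[symmetric])
    finally show ?thesis .
  qed
  then have "(\<integral>\<^sup>+x. (\<Sum>k. ennreal (u k x)) \<partial>M) \<le> (\<Sum>k. ennreal ((1/2) ^ k))"
    by (subst nn_integral_suminf) (auto intro!: suminf_le)
  also have "\<dots> = ennreal (\<Sum>k. (1/2) ^ k)"
    by (intro suminf_ennreal2) (auto intro: summable_geometric)
  finally have "(\<integral>\<^sup>+x. (\<Sum>k. ennreal (u k x)) \<partial>M) \<noteq> \<infinity>"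
    using ennreal_less_top le_less_trans by (metis infinity_ennreal_def less_irrefl)
  then have "AE x in M. (\<Sum>k. ennreal (u k x)) \<noteq> \<infinity>"
    by (intro nn_integral_PInf_AE) auto
  then show ?thesis
  proof eventually_elim
    case (elim x)
    then have "summable (\<lambda>k. u k x)"
      by (intro summable_suminf_not_top) (auto simp: u0)
    then have "Bseq (\<lambda>k. u k x)"
      by (intro convergent_imp_Bseq convergentI[OF summable_LIMSEQ_zero])
    then obtain C where C: "C > 0" "\<And>k. \<bar>u k x\<bar> \<le> C"
      by (auto simp: Bseq_def)
    have "cmod (Y (Suc k) x - Y k x) \<le> sqrt C * (1 / sqrt 2) ^ k" for k
    proof -
      have "(cmod (Y (Suc k) x - Y k x))\<^sup>2 \<le> C / 2 ^ k"
        using C(2)[of k] u0[of k x] by (simp add: u_def field_simps)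
      then have "cmod (Y (Suc k) x - Y k x) \<le> sqrt (C / 2 ^ k)"
        by (rule real_le_rsqrt)
      then show ?thesis by (simp add: real_sqrt_divide real_sqrt_power power_divide)
    qed
    then have "summable (\<lambda>k. Y (Suc k) x - Y k x)"
      by (intro summable_comparison_test'[OF summable_mult[OF summable_geometric], of "1 / sqrt 2" 0 _ "sqrt C"])
        simp_all
    then have "convergent (\<lambda>n. \<Sum>k<n. Y (Suc k) x - Y k x)"
      by (simp add: summable_iff_convergent)
    then have "convergent (\<lambda>n. Y n x - Y 0 x)"
      unfolding sum_lessThan_telescope[of "\<lambda>k. Y k x"] .
    then show ?case using convergent_diff_const_right_iff by blast
  qed
qed

text \<open>
  Riesz--Fischer: a rapidly converging subsequence has a pointwise limit almost everywhere, and
  by Fatou's lemma the whole Cauchy sequence converges to this limit in mean.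
\<close>

lemma L2_complete:
  fixes X :: "nat \<Rightarrow> 'a \<Rightarrow> complex"
  assumes X: "\<And>n. square_integrable M (X n)"
    and Cauchy: "\<And>e. e > 0 \<Longrightarrow> \<exists>N. \<forall>m\<ge>N. \<forall>n\<ge>N. (\<integral>x. (cmod (X m x - X n x))\<^sup>2 \<partial>M) < e"
  obtains L where "square_integrable M L" "(\<lambda>n. \<integral>x. (cmod (X n x - L x))\<^sup>2 \<partial>M) \<longlonglongrightarrow> 0"
proof -
  have Xm[measurable]: "X n \<in> borel_measurable M" for n
    using X by (simp add: square_integrable_def)
  have sq_diff: "square_integrable M (\<lambda>x. f x - g x)"
    if "square_integrable M f" "square_integrable M g" for f g
    using square_integrable_add[OF that(1) square_integrable_scale[OF that(2), of "-1"]] by simp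
  have "\<exists>N. \<forall>k. (\<forall>m\<ge>N k. \<forall>n\<ge>N k. (\<integral>x. (cmod (X m x - X n x))\<^sup>2 \<partial>M) < (1/4)^k)"
    using Cauchy[of "(1/4) ^ _"] by (intro choice allI) auto
  then obtain N where N: "\<And>k m n. m \<ge> N k \<Longrightarrow> n \<ge> N k \<Longrightarrow> (\<integral>x. (cmod (X m x - X n x))\<^sup>2 \<partial>M) < (1/4)^k"
    by blast
  define r where "r k = (\<Sum>i\<le>k. N i) + k" for k
  have r_N: "N k \<le> r k" for k unfolding r_def by (simp add: member_le_sum trans_le_add1)
  have r_Suc: "r k \<le> r (Suc k)" for k by (simp add: r_def)
  have r_k: "k \<le> r k" for k by (simp add: r_def)
  have conv: "AE x in M. convergent (\<lambda>k. X (r k) x)"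
  proof (rule rapidly_Cauchy_AE_convergent)
    fix k
    have "(\<integral>x. (cmod (X (r (Suc k)) x - X (r k) x))\<^sup>2 \<partial>M) < (1/4)^k"
      using r_N[of k] r_Suc[of k] by (intro N) auto
    then show "(\<integral>\<^sup>+x. ennreal ((cmod (X (r (Suc k)) x - X (r k) x))\<^sup>2) \<partial>M) \<le> ennreal ((1/4) ^ k)"
      by (subst square_integrable_nn_integral[OF sq_diff[OF X X]]) (simp add: ennreal_leI)
  qed measurable
  define L where "L x = lim (\<lambda>k. X (r k) x)" for x
  have Lm[measurable]: "L \<in> borel_measurable M"
    unfolding L_def by measurable
  have Fatou: "(\<integral>\<^sup>+x. ennreal ((cmod (X n x - L x))\<^sup>2) \<partial>M) \<le> ennreal e"
    if "\<And>m. m \<ge> K \<Longrightarrow> (\<integral>x. (cmod (X n x - X m x))\<^sup>2 \<partial>M) < e" for n K e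
  proof -
    have "(\<integral>\<^sup>+x. ennreal ((cmod (X n x - L x))\<^sup>2) \<partial>M)
        = (\<integral>\<^sup>+x. liminf (\<lambda>k. ennreal ((cmod (X n x - X (r k) x))\<^sup>2)) \<partial>M)"
    proof (rule nn_integral_cong_AE, use conv in eventually_elim)
      case (elim x)
      then have "(\<lambda>k. X (r k) x) \<longlonglongrightarrow> L x" by (simp add: L_def convergent_LIMSEQ_iff)
      then have "(\<lambda>k. ennreal ((cmod (X n x - X (r k) x))\<^sup>2)) \<longlonglongrightarrow> ennreal ((cmod (X n x - L x))\<^sup>2)"
        by (intro tendsto_ennrealI tendsto_intros)
      then show ?case by (intro lim_imp_Liminf[symmetric]) simp_all
    qed
    also have "\<dots> \<le> liminf (\<lambda>k. \<integral>\<^sup>+x. ennreal ((cmod (X n x - X (r k) x))\<^sup>2) \<partial>M)"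
      by (intro nn_integral_liminf) measurable
    also have "\<dots> \<le> liminf (\<lambda>k. ennreal e)"
    proof (intro Liminf_mono eventually_sequentiallyI)
      fix k assume "K \<le> k"
      then show "(\<integral>\<^sup>+x. ennreal ((cmod (X n x - X (r k) x))\<^sup>2) \<partial>M) \<le> ennreal e"
        using that[of "r k"] r_k[of k]
        by (subst square_integrable_nn_integral[OF sq_diff[OF X X]]) (simp add: ennreal_leI)
    qed
    also have "\<dots> = ennreal e" by (simp add: Liminf_const)
    finally show ?thesis .
  qed
  have sqn: "square_integrable M (\<lambda>x. X (N 0) x - L x)"
  proof (rule square_integrableI)
    have "(\<integral>\<^sup>+x. ennreal ((cmod (X (N 0) x - L x))\<^sup>2) \<partial>M) \<le> ennreal 1"
      using N[of 0 "N 0"] by (intro Fatou[of "N 0"]) auto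
    then show "(\<integral>\<^sup>+x. ennreal ((cmod (X (N 0) x - L x))\<^sup>2) \<partial>M) < \<infinity>"
      using le_less_trans ennreal_less_top by fastforce
  qed measurable
  have sqL: "square_integrable M L"
    using sq_diff[OF X[of "N 0"] sqn] by simp
  moreover have "(\<lambda>n. \<integral>x. (cmod (X n x - L x))\<^sup>2 \<partial>M) \<longlonglongrightarrow> 0"
  proof (rule LIMSEQ_I)
    fix e :: real assume "e > 0"
    then obtain K where K: "\<And>m n. m \<ge> K \<Longrightarrow> n \<ge> K \<Longrightarrow> (\<integral>x. (cmod (X m x - X n x))\<^sup>2 \<partial>M) < e / 2"
      using Cauchy[of "e / 2"] by auto
    have "norm ((\<integral>x. (cmod (X n x - L x))\<^sup>2 \<partial>M) - 0) < e" if "n \<ge> K" for n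
    proof -
      have "ennreal (\<integral>x. (cmod (X n x - L x))\<^sup>2 \<partial>M) \<le> ennreal (e / 2)"
        using Fatou[of K n "e / 2"] K that square_integrable_nn_integral[OF sq_diff[OF X[of n] sqL]]
        by auto
      then show ?thesis using \<open>e > 0\<close> by simp
    qed
    then show "\<exists>K. \<forall>n\<ge>K. norm ((\<integral>x. (cmod (X n x - L x))\<^sup>2 \<partial>M) - 0) < e" by blast
  qed
  ultimately show ?thesis using that by blast
qed

lemma square_integrable_0 [simp]: "square_integrable M (\<lambda>x. 0)"
  by (simp add: square_integrable_def)

lemma L2_space_simps:
  "vzero (L2_space M) = ae_rep M (\<lambda>x. 0)"
  "vplus (L2_space M) f g = ae_rep M (\<lambda>x. f x + g x)"
  "vscale (L2_space M) c f = ae_rep M (\<lambda>x. c * f x)"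
  by (simp_all add: L2_space_def)

lemma L2_plus_closed:
  assumes "f \<in> vecs (L2_space M)" "g \<in> vecs (L2_space M)"
  shows "vplus (L2_space M) f g \<in> vecs (L2_space M)"
    "AE x in M. vplus (L2_space M) f g x = f x + g x"
  using L2_space_vecs(1)[OF assms(1)] L2_space_vecs(1)[OF assms(2)]
  by (auto simp: L2_space_simps square_integrable_def
      intro!: ae_rep_in_L2 AE_ae_rep square_integrable_add)

lemma L2_scale_closed:
  assumes "f \<in> vecs (L2_space M)"
  shows "vscale (L2_space M) c f \<in> vecs (L2_space M)"
    "AE x in M. vscale (L2_space M) c f x = c * f x"
  using L2_space_vecs(1)[OF assms]
  by (auto simp: L2_space_simps square_integrable_def
      intro!: ae_rep_in_L2 AE_ae_rep square_integrable_scale)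

lemma L2_zero_closed:
  "vzero (L2_space M) \<in> vecs (L2_space M)" "AE x in M. vzero (L2_space M) x = 0"
  by (auto simp: L2_space_simps intro!: ae_rep_in_L2 AE_ae_rep)

lemma L2_inner_cong:
  assumes "AE x in M. f x = f' x" "AE x in M. g x = g' x"
    and "f \<in> borel_measurable M" "f' \<in> borel_measurable M"
    and "g \<in> borel_measurable M" "g' \<in> borel_measurable M"
  shows "vinner (L2_space M) f g = vinner (L2_space M) f' g'"
  unfolding L2_space_def inner_space.simps
  by (rule integral_cong_AE) (use assms in auto)

lemma hilbert_space_L2: "hilbert_space (L2_space (M :: 'a measure))"
proof
  let ?H = "L2_space M"
  show "vzero ?H \<in> vecs ?H" by (rule L2_zero_closed)
  fix f assume f: "f \<in> vecs ?H"
  note fm = L2_space_vecs[OF f]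
  show "vscale ?H c f \<in> vecs ?H" for c using f by (rule L2_scale_closed)
  show "vplus ?H f (vzero ?H) = f"
  proof (intro L2_space_eqI[of _ M] L2_plus_closed L2_zero_closed f)
    show "AE x in M. vplus ?H f (vzero ?H) x = f x"
      using L2_plus_closed(2)[OF f L2_zero_closed(1)] L2_zero_closed(2)[of M]
      by eventually_elim simp
  qed
  show "vplus ?H f (vscale ?H (-1) f) = vzero ?H"
  proof (intro L2_space_eqI[of _ M] L2_plus_closed L2_scale_closed L2_zero_closed f)
    show "AE x in M. vplus ?H f (vscale ?H (-1) f) x = vzero ?H x"
      using L2_plus_closed(2)[OF f L2_scale_closed(1)[OF f, of "-1"]] L2_zero_closed(2)[of M]
        L2_scale_closed(2)[OF f, of "-1"]
      by eventually_elim simp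
  qed
  show "vscale ?H 1 f = f"
  proof (intro L2_space_eqI[of _ M] L2_scale_closed f)
    show "AE x in M. vscale ?H 1 f x = f x"
      using L2_scale_closed(2)[OF f, of 1] by eventually_elim simp
  qed
  show "vscale ?H a (vscale ?H b f) = vscale ?H (a * b) f" for a b
  proof (intro L2_space_eqI[of _ M] L2_scale_closed f)
    show "AE x in M. vscale ?H a (vscale ?H b f) x = vscale ?H (a * b) f x"
      using L2_scale_closed(2)[OF L2_scale_closed(1)[OF f, of b], of a] L2_scale_closed(2)[OF f, of b]
        L2_scale_closed(2)[OF f, of "a * b"]
      by eventually_elim simp
  qed
  show "vscale ?H (a + b) f = vplus ?H (vscale ?H a f) (vscale ?H b f)" for a b
  proof (intro L2_space_eqI[of _ M] L2_scale_closed L2_plus_closed f)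
    show "AE x in M. vscale ?H (a + b) f x = vplus ?H (vscale ?H a f) (vscale ?H b f) x"
      using L2_scale_closed(2)[OF f, of a] L2_scale_closed(2)[OF f, of b]
        L2_scale_closed(2)[OF f, of "a + b"]
        L2_plus_closed(2)[OF L2_scale_closed(1)[OF f, of a] L2_scale_closed(1)[OF f, of b]]
      by eventually_elim (simp add: distrib_right)
  qed
  show "0 \<le> Re (vinner ?H f f)" by (simp add: L2_inner_self)
  show "f = vzero ?H" if "vinner ?H f f = 0"
  proof (rule L2_space_eqI[OF f L2_zero_closed(1)])
    have "AE x in M. (cmod (f x))\<^sup>2 = 0"
      using that fm(1) unfolding L2_inner_self square_integrable_def
      by (subst integral_nonneg_eq_0_iff_AE[symmetric]) auto
    then show "AE x in M. f x = vzero ?H x"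
      using L2_zero_closed(2)[of M] by eventually_elim simp
  qed
  fix g assume g: "g \<in> vecs ?H"
  note gm = L2_space_vecs[OF g]
  show "vplus ?H f g \<in> vecs ?H" using f g by (rule L2_plus_closed)
  show "vplus ?H f g = vplus ?H g f" by (simp add: L2_space_simps add.commute)
  show "vscale ?H a (vplus ?H f g) = vplus ?H (vscale ?H a f) (vscale ?H a g)" for a
  proof (intro L2_space_eqI[of _ M] L2_scale_closed L2_plus_closed f g)
    show "AE x in M. vscale ?H a (vplus ?H f g) x = vplus ?H (vscale ?H a f) (vscale ?H a g) x"
      using L2_scale_closed(2)[OF f, of a] L2_scale_closed(2)[OF g, of a] L2_plus_closed(2)[OF f g]
        L2_scale_closed(2)[OF L2_plus_closed(1)[OF f g], of a]
        L2_plus_closed(2)[OF L2_scale_closed(1)[OF f, of a] L2_scale_closed(1)[OF g, of a]]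
      by eventually_elim (simp add: distrib_left)
  qed
  show "vinner ?H (vscale ?H a f) g = a * vinner ?H f g" for a
  proof -
    have "vinner ?H (vscale ?H a f) g = vinner ?H (\<lambda>x. a * f x) g"
      using L2_scale_closed[OF f, of a] fm gm L2_space_vecs(2) by (intro L2_inner_cong) auto
    also have "\<dots> = a * vinner ?H f g"
      by (simp add: L2_space_def mult.assoc)
    finally show ?thesis .
  qed
  show "vinner ?H f g = cnj (vinner ?H g f)"
    unfolding L2_space_def inner_space.simps
    by (subst Bochner_Integration.integral_cnj[symmetric]) (simp add: mult.commute)
  fix h assume h: "h \<in> vecs ?H"
  note hm = L2_space_vecs[OF h]
  show "vplus ?H (vplus ?H f g) h = vplus ?H f (vplus ?H g h)"
  proof (intro L2_space_eqI[of _ M] L2_plus_closed f g h)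
    show "AE x in M. vplus ?H (vplus ?H f g) h x = vplus ?H f (vplus ?H g h) x"
      using L2_plus_closed(2)[OF f g] L2_plus_closed(2)[OF g h]
        L2_plus_closed(2)[OF L2_plus_closed(1)[OF f g] h]
        L2_plus_closed(2)[OF f L2_plus_closed(1)[OF g h]]
      by eventually_elim simp
  qed
  show "vinner ?H (vplus ?H f g) h = vinner ?H f h + vinner ?H g h"
  proof -
    have "vinner ?H (vplus ?H f g) h = vinner ?H (\<lambda>x. f x + g x) h"
      using L2_plus_closed[OF f g] fm gm hm L2_space_vecs(2) by (intro L2_inner_cong) auto
    also have "\<dots> = vinner ?H f h + vinner ?H g h"
      using integrable_L2_product[OF fm(1) hm(1)] integrable_L2_product[OF gm(1) hm(1)]
      by (simp add: L2_space_def distrib_right)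
    finally show ?thesis .
  qed
next
  let ?H = "L2_space M"
  fix X :: "nat \<Rightarrow> 'a \<Rightarrow> complex" assume X: "X n \<in> vecs ?H" for n
  assume C: "\<forall>e>0. \<exists>K. \<forall>m\<ge>K. \<forall>n\<ge>K. vdist ?H (X m) (X n) < e"
  have dist: "(vdist ?H f g)\<^sup>2 = (\<integral>x. (cmod (f x - g x))\<^sup>2 \<partial>M)"
    if f: "f \<in> vecs ?H" and g: "g \<in> vecs ?H" for f g
    unfolding vdist_def L2_norm_power2
  proof (rule integral_cong_AE)
    note p = L2_plus_closed[OF f L2_scale_closed(1)[OF g, of "-1"]]
    show "AE x in M. (cmod (vplus ?H f (vscale ?H (-1) g) x))\<^sup>2 = (cmod (f x - g x))\<^sup>2"
      using p(2) L2_scale_closed(2)[OF g, of "-1"] by eventually_elim simp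
    have [measurable]: "f \<in> borel_measurable M" "g \<in> borel_measurable M"
      "vplus ?H f (vscale ?H (-1) g) \<in> borel_measurable M"
      using L2_space_vecs(2) f g p by auto
    show "(\<lambda>x. (cmod (vplus ?H f (vscale ?H (-1) g) x))\<^sup>2) \<in> borel_measurable M"
      "(\<lambda>x. (cmod (f x - g x))\<^sup>2) \<in> borel_measurable M" by measurable
  qed
  have dist0: "0 \<le> vdist ?H f g" for f g unfolding vdist_def by (rule L2_norm_nonneg)
  obtain L where L: "square_integrable M L" "(\<lambda>n. \<integral>x. (cmod (X n x - L x))\<^sup>2 \<partial>M) \<longlonglongrightarrow> 0"
  proof (rule L2_complete[of M X])
    show "square_integrable M (X n)" for n using L2_space_vecs(1)[OF X] .
    fix e :: real assume "e > 0"
    then obtain K where K: "\<forall>m\<ge>K. \<forall>n\<ge>K. vdist ?H (X m) (X n) < sqrt e"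
      using C by (metis real_sqrt_gt_zero)
    have "(\<integral>x. (cmod (X m x - X n x))\<^sup>2 \<partial>M) < e" if "m \<ge> K" "n \<ge> K" for m n
    proof -
      have "(vdist ?H (X m) (X n))\<^sup>2 < (sqrt e)\<^sup>2"
        using K that dist0 by (intro power_strict_mono) auto
      then show ?thesis using \<open>e > 0\<close> dist[OF X X] by simp
    qed
    then show "\<exists>K. \<forall>m\<ge>K. \<forall>n\<ge>K. (\<integral>x. (cmod (X m x - X n x))\<^sup>2 \<partial>M) < e" by blast
  qed
  have rL: "ae_rep M L \<in> vecs ?H" using L(1) by (rule ae_rep_in_L2)
  have Lm: "L \<in> borel_measurable M" using L(1) by (simp add: square_integrable_def)
  have "(vdist ?H (X n) (ae_rep M L))\<^sup>2 = (\<integral>x. (cmod (X n x - L x))\<^sup>2 \<partial>M)" for n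
    unfolding dist[OF X rL]
  proof (rule integral_cong_AE)
    show "AE x in M. (cmod (X n x - ae_rep M L x))\<^sup>2 = (cmod (X n x - L x))\<^sup>2"
      using AE_ae_rep[OF Lm] by eventually_elim simp
    have [measurable]: "X n \<in> borel_measurable M" "ae_rep M L \<in> borel_measurable M"
      "L \<in> borel_measurable M"
      using L2_space_vecs(2)[OF X] L2_space_vecs(2)[OF rL] Lm by auto
    show "(\<lambda>x. (cmod (X n x - ae_rep M L x))\<^sup>2) \<in> borel_measurable M"
      "(\<lambda>x. (cmod (X n x - L x))\<^sup>2) \<in> borel_measurable M" by measurable
  qed
  then have "vdist ?H (X n) (ae_rep M L) = sqrt (\<integral>x. (cmod (X n x - L x))\<^sup>2 \<partial>M)" for n
    using dist0 by (metis real_sqrt_unique)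
  then have "(\<lambda>n. vdist ?H (X n) (ae_rep M L)) \<longlonglongrightarrow> 0"
    using tendsto_real_sqrt[OF L(2)] by simp
  then show "\<exists>L\<in>vecs ?H. (\<lambda>n. vdist ?H (X n) L) \<longlonglongrightarrow> 0" using rL by blast
qed

definition weighted_composition ::
    "'a measure \<Rightarrow> ('a \<Rightarrow> complex) \<Rightarrow> ('a \<Rightarrow> 'a) \<Rightarrow> ('a \<Rightarrow> complex) \<Rightarrow> 'a \<Rightarrow> complex" where
  "weighted_composition M g s f = ae_rep M (\<lambda>x. g x * f (s x))"

context
  fixes M :: "'a measure" and s :: "'a \<Rightarrow> 'a"
  assumes s [measurable]: "s \<in> M \<rightarrow>\<^sub>M M" and distr_s: "distr M M s = M"
begin

lemma AE_measure_preserving: "AE x in M. P x \<Longrightarrow> AE x in M. P (s x)"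
  using AE_distrD[OF s, of P] unfolding distr_s .

lemma integrable_measure_preserving:
  fixes f :: "'a \<Rightarrow> 'b::{banach, second_countable_topology}"
  assumes "integrable M f"
  shows "integrable M (\<lambda>x. f (s x))"
  using integrable_distr[OF s, of f] assms by (simp add: distr_s)

lemma integral_measure_preserving:
  fixes f :: "'a \<Rightarrow> 'b::{banach, second_countable_topology}"
  assumes "f \<in> borel_measurable M"
  shows "(\<integral>x. f (s x) \<partial>M) = (\<integral>x. f x \<partial>M)"
  using integral_distr[OF s assms] by (simp add: distr_s)

context
  fixes g :: "'a \<Rightarrow> complex" and C :: real
  assumes g [measurable]: "g \<in> borel_measurable M" and g_le: "\<And>x. cmod (g x) \<le> C"
begin

lemma square_integrable_weighted_composition:
  assumes "square_integrable M f"
  shows "square_integrable M (\<lambda>x. g x * f (s x))"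
proof (rule square_integrable_mult_bounded[OF _ g g_le])
  show "square_integrable M (\<lambda>x. f (s x))"
    using assms integrable_measure_preserving[of "\<lambda>x. (cmod (f x))\<^sup>2"]
    by (auto simp: square_integrable_def)
qed

lemma AE_weighted_composition:
  assumes "square_integrable M f"
  shows "AE x in M. weighted_composition M g s f x = g x * f (s x)"
  using square_integrable_weighted_composition[OF assms]
  unfolding weighted_composition_def by (intro AE_ae_rep) (simp add: square_integrable_def)

lemma weighted_composition_in_L2:
  "square_integrable M f \<Longrightarrow> weighted_composition M g s f \<in> vecs (L2_space M)"
  unfolding weighted_composition_def
  by (intro ae_rep_in_L2 square_integrable_weighted_composition)

lemma bounded_operator_weighted_composition:
  "bounded_operator (L2_space M) (weighted_composition M g s)"
  unfolding bounded_operator_def linear_map_def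
proof (intro conjI ballI allI)
  let ?H = "L2_space M" and ?T = "weighted_composition M g s"
  fix f assume f: "f \<in> vecs ?H"
  note sf = L2_space_vecs(1)[OF f]
  note Tf = AE_weighted_composition[OF sf]
  show Tf_vec: "?T f \<in> vecs ?H" using sf by (rule weighted_composition_in_L2)
  show "?T (vscale ?H c f) = vscale ?H c (?T f)" for c
  proof (rule L2_space_eqI)
    note cf = L2_scale_closed[OF f, of c]
    show "?T (vscale ?H c f) \<in> vecs ?H"
      using L2_space_vecs(1)[OF cf(1)] by (rule weighted_composition_in_L2)
    show "vscale ?H c (?T f) \<in> vecs ?H" using Tf_vec by (rule L2_scale_closed)
    show "AE x in M. ?T (vscale ?H c f) x = vscale ?H c (?T f) x"
      using AE_weighted_composition[OF L2_space_vecs(1)[OF cf(1)]] AE_measure_preserving[OF cf(2)]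
        Tf L2_scale_closed(2)[OF Tf_vec, of c]
      by eventually_elim simp
  qed
  fix h assume h: "h \<in> vecs ?H"
  note sh = L2_space_vecs(1)[OF h]
  note Th = AE_weighted_composition[OF sh]
  have Th_vec: "?T h \<in> vecs ?H" using sh by (rule weighted_composition_in_L2)
  show "?T (vplus ?H f h) = vplus ?H (?T f) (?T h)"
  proof (rule L2_space_eqI)
    note fh = L2_plus_closed[OF f h]
    show "?T (vplus ?H f h) \<in> vecs ?H"
      using L2_space_vecs(1)[OF fh(1)] by (rule weighted_composition_in_L2)
    show "vplus ?H (?T f) (?T h) \<in> vecs ?H" using Tf_vec Th_vec by (rule L2_plus_closed)
    show "AE x in M. ?T (vplus ?H f h) x = vplus ?H (?T f) (?T h) x"
      using AE_weighted_composition[OF L2_space_vecs(1)[OF fh(1)]] AE_measure_preserving[OF fh(2)]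
        Tf Th L2_plus_closed(2)[OF Tf_vec Th_vec]
      by eventually_elim (simp add: distrib_left)
  qed
next
  let ?H = "L2_space M" and ?T = "weighted_composition M g s"
  have C: "0 \<le> C" using g_le norm_ge_zero order_trans by blast
  have "vnorm ?H (?T f) \<le> C * vnorm ?H f" if f: "f \<in> vecs ?H" for f
  proof (rule power2_le_imp_le)
    note sf = L2_space_vecs(1)[OF f]
    have [measurable]: "f \<in> borel_measurable M" using sf by (simp add: square_integrable_def)
    have int: "integrable M (\<lambda>x. (cmod (f x))\<^sup>2)" using sf by (simp add: square_integrable_def)
    have "(vnorm ?H (?T f))\<^sup>2 \<le> (\<integral>x. C\<^sup>2 * (cmod (f (s x)))\<^sup>2 \<partial>M)"
      unfolding L2_norm_power2
    proof (rule integral_mono_AE)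
      show "integrable M (\<lambda>x. (cmod (?T f x))\<^sup>2)"
        using L2_space_vecs(1)[OF weighted_composition_in_L2[OF sf]] by (simp add: square_integrable_def)
      show "integrable M (\<lambda>x. C\<^sup>2 * (cmod (f (s x)))\<^sup>2)"
        using integrable_measure_preserving[OF int] by simp
      show "AE x in M. (cmod (?T f x))\<^sup>2 \<le> C\<^sup>2 * (cmod (f (s x)))\<^sup>2"
        using AE_weighted_composition[OF sf]
        by eventually_elim (simp add: norm_mult power_mult_distrib mult_right_mono power_mono g_le)
    qed
    also have "\<dots> = (C * vnorm ?H f)\<^sup>2"
      using integral_measure_preserving[of "\<lambda>x. (cmod (f x))\<^sup>2"]
      by (simp add: power_mult_distrib L2_norm_power2)
    finally show "(vnorm ?H (?T f))\<^sup>2 \<le> (C * vnorm ?H f)\<^sup>2" .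
  qed (simp add: C L2_norm_nonneg)
  then show "\<exists>C. \<forall>f\<in>vecs ?H. vnorm ?H (?T f) \<le> C * vnorm ?H f" by blast
qed

end

end

text \<open>
  The adjoint is the composition with the inverse bijection, weighted by the conjugate of \<open>g\<close>.
  Because \<open>g\<close> is invariant, both products of the operator with its adjoint multiply by \<open>|g|\<^sup>2\<close>.
\<close>

lemma normal_operator_weighted_composition:
  fixes M :: "'a measure" and g :: "'a \<Rightarrow> complex"
  assumes g [measurable]: "g \<in> borel_measurable M" and g_le: "\<And>x. cmod (g x) \<le> C"
    and s [measurable]: "s \<in> M \<rightarrow>\<^sub>M M" and ds: "distr M M s = M"
    and t [measurable]: "t \<in> M \<rightarrow>\<^sub>M M" and dt: "distr M M t = M"
    and st: "\<And>x. s (t x) = x" and ts: "\<And>x. t (s x) = x" and gs: "\<And>x. g (s x) = g x"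
  shows "normal_operator (L2_space M) (weighted_composition M g s)"
proof -
  let ?H = "L2_space M" and ?N = "weighted_composition M g s"
  let ?A = "weighted_composition M (\<lambda>x. cnj (g x)) t"
  have g' [measurable]: "(\<lambda>x. cnj (g x)) \<in> borel_measurable M" by measurable
  have g'_le: "cmod (cnj (g x)) \<le> C" for x using g_le by simp
  have gt: "g (t x) = g x" for x using gs[of "t x"] by (simp add: st)
  note N = weighted_composition_in_L2[OF s ds g g_le] AE_weighted_composition[OF s ds g g_le]
  note A = weighted_composition_in_L2[OF t dt g' g'_le] AE_weighted_composition[OF t dt g' g'_le]
  have "vinner ?H (?N f) h = vinner ?H f (?A h)" if f: "f \<in> vecs ?H" and h: "h \<in> vecs ?H" for f h
  proof -
    have [measurable]: "f \<in> borel_measurable M" "h \<in> borel_measurable M"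
      "?N f \<in> borel_measurable M" "?A h \<in> borel_measurable M"
      using L2_space_vecs f h N(1) A(1) by blast+
    have "vinner ?H (?N f) h = vinner ?H (\<lambda>x. g x * f (s x)) h"
      using N(2)[OF L2_space_vecs(1)[OF f]] by (intro L2_inner_cong) auto
    also have "\<dots> = (\<integral>x. g (s x) * f (s x) * cnj (h (t (s x))) \<partial>M)"
      by (simp add: L2_space_def gs ts)
    also have "\<dots> = (\<integral>x. g x * f x * cnj (h (t x)) \<partial>M)"
      by (rule integral_measure_preserving[OF s ds, of "\<lambda>x. g x * f x * cnj (h (t x))"]) measurable
    also have "\<dots> = vinner ?H f (\<lambda>x. cnj (g x) * h (t x))"
      by (simp add: L2_space_def mult_ac)
    also have "\<dots> = vinner ?H f (?A h)"
      using A(2)[OF L2_space_vecs(1)[OF h]] by (intro L2_inner_cong) auto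
    finally show ?thesis .
  qed
  then have "adjoint_of ?H ?N ?A"
    unfolding adjoint_of_def using bounded_operator_weighted_composition[OF t dt g' g'_le] by blast
  moreover have "?N (?A f) = ?A (?N f)" if f: "f \<in> vecs ?H" for f
  proof (rule L2_space_eqI)
    note sf = L2_space_vecs(1)[OF f]
    note sA = L2_space_vecs(1)[OF A(1)[OF sf]] and sN = L2_space_vecs(1)[OF N(1)[OF sf]]
    show "?N (?A f) \<in> vecs ?H" "?A (?N f) \<in> vecs ?H"
      using N(1)[OF sA] A(1)[OF sN] by auto
    show "AE x in M. ?N (?A f) x = ?A (?N f) x"
      using N(2)[OF sA] A(2)[OF sN] AE_measure_preserving[OF s ds A(2)[OF sf]]
        AE_measure_preserving[OF t dt N(2)[OF sf]]
      by eventually_elim (simp add: st ts gs gt)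
  qed
  ultimately show ?thesis
    unfolding normal_operator_def using bounded_operator_weighted_composition[OF s ds g g_le] by blast
qed


section \<open>Powers of weighted shifts\<close>

definition weight_prod :: "(nat \<Rightarrow> real) \<Rightarrow> nat \<Rightarrow> real" where
  "weight_prod \<beta> n = (\<Prod>i<n. \<beta> i)"

lemma moment_weight_prod: "moment \<beta> n = (weight_prod \<beta> n)\<^sup>2"
  by (simp add: moment_def weight_prod_def prod_power_distrib)

lemma weight_prod_pos: "weight_sequence \<beta> \<Longrightarrow> 0 < weight_prod \<beta> n"
  by (auto simp: weight_prod_def weight_sequence_def intro!: prod_pos)

lemma weighted_shift_power:
  assumes "weight_sequence \<beta>"
  shows "(weighted_shift \<beta> ^^ l) f n =
    (if n < l then 0 else of_real (weight_prod \<beta> n / weight_prod \<beta> (n - l)) * f (n - l))"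
proof (induction l arbitrary: n)
  case 0
  then show ?case using weight_prod_pos[OF assms, of n] by simp
next
  case (Suc l)
  show ?case
  proof (cases n)
    case 0
    then show ?thesis by (simp add: weighted_shift_def)
  next
    case (Suc k)
    have "(weighted_shift \<beta> ^^ Suc l) f n = of_real (\<beta> k) * (weighted_shift \<beta> ^^ l) f k"
      unfolding Suc by (simp add: weighted_shift_def)
    then show ?thesis unfolding Suc.IH Suc by (simp add: weight_prod_def)
  qed
qed

lemma ell2_inner_self: "f \<in> vecs ell2 \<Longrightarrow> vinner ell2 f f = of_real (\<Sum>n. (cmod (f n))\<^sup>2)"
proof -
  assume "f \<in> vecs ell2"
  then have "summable (\<lambda>n. (cmod (f n))\<^sup>2)" by (simp add: ell2_def)
  moreover have "(\<lambda>n. f n * cnj (f n)) = (\<lambda>n. of_real ((cmod (f n))\<^sup>2))"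
    by (simp only: complex_norm_square)
  ultimately show ?thesis
    by (simp only: ell2_def inner_space.simps suminf_of_real)
qed

lemma bounded_operator_weighted_shift:
  assumes "weight_sequence \<beta>"
  shows "bounded_operator ell2 (weighted_shift \<beta>)"
proof -
  obtain C where C: "\<And>n. \<bar>\<beta> n\<bar> \<le> C"
    using assms by (auto simp: weight_sequence_def bounded_iff)
  have C0: "0 \<le> C" using C[of 0] by linarith
  have le: "(cmod (weighted_shift \<beta> f (Suc n)))\<^sup>2 \<le> C\<^sup>2 * (cmod (f n))\<^sup>2" for f n
    unfolding power_mult_distrib[symmetric]
    by (intro power_mono) (auto simp: weighted_shift_def norm_mult intro!: mult_right_mono C)
  have W0: "weighted_shift \<beta> f 0 = 0" for f by (simp add: weighted_shift_def)
  have summable_W: "summable (\<lambda>n. (cmod (weighted_shift \<beta> f n))\<^sup>2)" if "f \<in> vecs ell2" for f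
  proof (subst summable_Suc_iff[symmetric], rule summable_comparison_test')
    show "summable (\<lambda>n. C\<^sup>2 * (cmod (f n))\<^sup>2)"
      using that by (intro summable_mult) (simp add: ell2_def)
    show "norm ((cmod (weighted_shift \<beta> f (Suc n)))\<^sup>2) \<le> C\<^sup>2 * (cmod (f n))\<^sup>2" for n
      using le by simp
  qed
  have closed: "weighted_shift \<beta> f \<in> vecs ell2" if "f \<in> vecs ell2" for f
    using summable_W[OF that] by (simp add: ell2_def)
  have "vnorm ell2 (weighted_shift \<beta> f) \<le> C * vnorm ell2 f" if f: "f \<in> vecs ell2" for f
  proof -
    have sf: "summable (\<lambda>n. (cmod (f n))\<^sup>2)" using f by (simp add: ell2_def)
    have "(\<Sum>n. (cmod (weighted_shift \<beta> f n))\<^sup>2) = (\<Sum>n. (cmod (weighted_shift \<beta> f (Suc n)))\<^sup>2)"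
      using suminf_split_head[OF summable_W[OF f]] by (simp add: W0)
    also have "\<dots> \<le> (\<Sum>n. C\<^sup>2 * (cmod (f n))\<^sup>2)"
      using summable_W[OF f, THEN summable_Suc_iff[THEN iffD2]] sf
      by (intro suminf_le le summable_mult)
    also have "\<dots> = C\<^sup>2 * (\<Sum>n. (cmod (f n))\<^sup>2)" using sf by (rule suminf_mult)
    finally have "sqrt (\<Sum>n. (cmod (weighted_shift \<beta> f n))\<^sup>2) \<le> sqrt (C\<^sup>2 * (\<Sum>n. (cmod (f n))\<^sup>2))"
      by (rule real_sqrt_le_mono)
    then show ?thesis
      using C0 by (simp add: vnorm_def ell2_inner_self[OF f] ell2_inner_self[OF closed[OF f]]
          real_sqrt_mult)
  qed
  moreover have "linear_map ell2 ell2 (weighted_shift \<beta>)"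
    unfolding linear_map_def using closed
    by (auto simp: ell2_def weighted_shift_def fun_eq_iff algebra_simps split: nat.split)
  ultimately show ?thesis unfolding bounded_operator_def by blast
qed

lemma bounded_operator_funpow:
  assumes T: "bounded_operator H T" and nonneg: "\<And>x. x \<in> vecs H \<Longrightarrow> 0 \<le> Re (vinner H x x)"
  shows "bounded_operator H (T ^^ n)"
proof (induction n)
  case 0
  show ?case by (auto simp: bounded_operator_def linear_map_def intro!: exI[of _ 1])
next
  case (Suc n)
  obtain C where C: "\<And>x. x \<in> vecs H \<Longrightarrow> vnorm H (T x) \<le> C * vnorm H x"
    using T by (auto simp: bounded_operator_def)
  obtain D where D: "\<And>x. x \<in> vecs H \<Longrightarrow> vnorm H ((T ^^ n) x) \<le> D * vnorm H x"
    using Suc by (auto simp: bounded_operator_def)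
  have closed: "(T ^^ n) x \<in> vecs H" if "x \<in> vecs H" for x
    using Suc that by (auto simp: bounded_operator_def linear_map_def)
  have "vnorm H ((T ^^ Suc n) x) \<le> (\<bar>C\<bar> * D) * vnorm H x" if x: "x \<in> vecs H" for x
  proof -
    have "vnorm H ((T ^^ Suc n) x) \<le> C * vnorm H ((T ^^ n) x)"
      using C[OF closed[OF x]] by simp
    also have "\<dots> \<le> \<bar>C\<bar> * vnorm H ((T ^^ n) x)"
      using nonneg[OF closed[OF x]] by (intro mult_right_mono) (auto simp: vnorm_def)
    also have "\<dots> \<le> \<bar>C\<bar> * (D * vnorm H x)" by (intro mult_left_mono D x) auto
    finally show ?thesis by (simp add: mult_ac)
  qed
  moreover have "linear_map H H (T ^^ Suc n)"
    using T Suc by (auto simp: bounded_operator_def linear_map_def)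
  ultimately show ?case unfolding bounded_operator_def by blast
qed

lemma bounded_operator_weighted_shift_power:
  assumes "weight_sequence \<beta>"
  shows "bounded_operator ell2 (weighted_shift \<beta> ^^ l)"
proof (rule bounded_operator_funpow[OF bounded_operator_weighted_shift[OF assms]])
  show "0 \<le> Re (vinner ell2 f f)" if "f \<in> vecs ell2" for f
    using ell2_inner_self[OF that] that by (simp add: suminf_nonneg) (simp add: suminf_nonneg ell2_def)
qed

lemma basis_vec_in_ell2: "basis_vec n \<in> vecs ell2"
  using summable_finite[of "{n}" "\<lambda>k. (cmod (basis_vec n k))\<^sup>2"]
  by (auto simp: ell2_def basis_vec_def)

lemma weighted_shift_power_basis_vec_0:
  assumes "weight_sequence \<beta>"
  shows "(weighted_shift \<beta> ^^ l) (basis_vec 0) = vscale ell2 (of_real (weight_prod \<beta> l)) (basis_vec l)"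
  unfolding fun_eq_iff weighted_shift_power[OF assms]
  by (auto simp: basis_vec_def ell2_def weight_prod_def)

lemma ell2_inner_basis_vec:
  "vinner ell2 (vscale ell2 (of_real c) (basis_vec n)) (vscale ell2 (of_real c) (basis_vec n)) = of_real (c\<^sup>2)"
proof -
  have "(\<lambda>k. of_real c * basis_vec n k * cnj (of_real c * basis_vec n k))
      = (\<lambda>k. if k = n then complex_of_real (c\<^sup>2) else 0)"
    by (auto simp: basis_vec_def power2_eq_square)
  then show ?thesis
    using sums_unique[OF sums_single[of n "\<lambda>k. complex_of_real (c\<^sup>2)"]] by (simp add: ell2_def)
qed

lemma weight_sequence_back_step:
  assumes "weight_sequence \<alpha>" "0 < x"
  shows "weight_sequence (back_step x \<alpha>)"
proof -
  have "range (back_step x \<alpha>) \<subseteq> insert x (range \<alpha>)"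
    by (auto simp: back_step_def split: nat.split)
  moreover have "bounded (insert x (range \<alpha>))"
    using assms by (simp add: weight_sequence_def)
  ultimately have "bounded (range (back_step x \<alpha>))" using bounded_subset by blast
  then show ?thesis
    using assms by (auto simp: weight_sequence_def back_step_def split: nat.split)
qed

lemma moment_back_step: "moment (back_step x \<alpha>) (Suc n) = x\<^sup>2 * moment \<alpha> n"
  unfolding moment_def prod.lessThan_Suc_shift by (simp add: back_step_def)

lemma moment_0 [simp]: "moment \<beta> 0 = 1"
  by (simp add: moment_def)


section \<open>Subnormality of the powers of a back-step extension\<close>

text \<open>By Lindelof's theorem countably many open null sets cover the complement of the support.\<close>

lemma AE_measure_support:
  assumes "sets \<mu> = sets borel"
  shows "AE t in \<mu>. t \<in> measure_support \<mu>"
proof -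
  define F where "F = {U. open U \<and> emeasure \<mu> U = 0}"
  obtain F' where F': "F' \<subseteq> F" "countable F'" "\<Union>F' = \<Union>F"
    using Lindelof[of F] by (auto simp: F_def)
  have "(\<Union>U\<in>F'. U) \<in> null_sets \<mu>"
    using F' assms by (intro null_sets_UN') (auto simp: F_def null_sets_def)
  then show ?thesis
  proof (rule AE_I')
    show "{t \<in> space \<mu>. t \<notin> measure_support \<mu>} \<subseteq> (\<Union>U\<in>F'. U)"
      using F'(3) by (auto simp: measure_support_def F_def)
  qed
qed

locale shift_moment_measure = prob_space \<mu> for \<mu> :: "real measure" +
  fixes \<alpha> :: "nat \<Rightarrow> real" and R x :: real
  assumes sets_\<mu> [measurable_cong]: "sets \<mu> = sets borel"
    and AE_R: "AE t in \<mu>. 0 \<le> t \<and> t \<le> R"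
    and R_pos: "0 < R"
    and weights: "weight_sequence \<alpha>"
    and moment_eq: "moment \<alpha> n = (\<integral>t. t ^ n \<partial>\<mu>)"
    and x_pos: "0 < x"
begin

lemma integrable_bounded:
  assumes "f \<in> borel_measurable borel" "\<And>t. 0 \<le> t \<Longrightarrow> t \<le> R \<Longrightarrow> norm (f t) \<le> B"
  shows "integrable \<mu> (f :: real \<Rightarrow> real)"
proof (rule integrable_const_bound)
  show "AE t in \<mu>. norm (f t) \<le> B" using AE_R by eventually_elim (use assms(2) in auto)
  show "f \<in> borel_measurable \<mu>"
    using assms(1) by (simp add: measurable_cong_sets[OF sets_\<mu>])
qed

lemma moment_back_step_integral:
  "n \<ge> 1 \<Longrightarrow> moment (back_step x \<alpha>) n = x\<^sup>2 * (\<integral>t. t ^ (n - 1) \<partial>\<mu>)"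
  using moment_back_step[of x \<alpha> "n - 1"] by (simp add: moment_eq)

text \<open>
  Let \<open>u = t\<^sup>l / R\<^sup>l\<close>. The positivity of even differences, applied to the image of \<open>e\<^sub>0\<close>, yields
  \<open>x\<^sup>2 \<integral> (1 - (1 - u)\<^sup>2\<^sup>n) / t d\<mu> \<le> 1\<close> for every \<open>n\<close>. As \<open>n\<close> grows, \<open>(1 - u)\<^sup>2\<^sup>n\<close>
  tends to 0 for \<open>t > 0\<close>, and Fatou's lemma gives the claim.
\<close>

lemma subnormal_power_imp_integral_le:
  assumes l: "l \<ge> 1" and sub: "subnormal_operator ell2 (weighted_shift (back_step x \<alpha>) ^^ l)"
  shows "(\<integral>\<^sup>+t. ennreal \<bar>1 / t\<bar> \<partial>\<mu>) \<le> ennreal (1 / x\<^sup>2)"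
proof -
  let ?\<beta> = "back_step x \<alpha>"
  let ?T = "weighted_shift ?\<beta> ^^ l"
  note \<beta> = weight_sequence_back_step[OF weights x_pos]
  define C where "C = R ^ l"
  have C: "0 < C" using R_pos by (simp add: C_def)
  define q where "q m t = (1 - t ^ l / C) ^ m" for m and t :: real
  have [measurable]: "q m \<in> borel_measurable borel" for m unfolding q_def by measurable
  have u01: "0 \<le> t ^ l / C" "t ^ l / C \<le> 1" if "0 \<le> t" "t \<le> R" for t
    using that C by (auto simp: C_def power_mono)
  have q01: "0 \<le> q m t" "q m t \<le> 1" if "0 \<le> t" "t \<le> R" for m t
    using u01[OF that] by (auto simp: q_def power_le_one)
  have int_q: "integrable \<mu> (\<lambda>t. q m t * t ^ j)" for m j
  proof (rule integrable_bounded)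
    fix t assume t: "0 \<le> t" "t \<le> R"
    have "q m t * t ^ j \<le> 1 * R ^ j"
      using q01[OF t] t by (intro mult_mono power_mono) auto
    then show "norm (q m t * t ^ j) \<le> R ^ j" using q01[OF t] t by simp
  qed measurable
  define G where "G m j = (\<integral>t. q m t * t ^ j \<partial>\<mu>)" for m j
  have G_0: "G 0 j = (\<integral>t. t ^ j \<partial>\<mu>)" for j by (simp add: G_def q_def)
  have G_Suc: "G (Suc m) j = G m j - 1 / C * G m (j + l)" for m j
  proof -
    have "q (Suc m) t * t ^ j = q m t * t ^ j - 1 / C * (q m t * t ^ (j + l))" for t
      by (simp add: q_def power_add algebra_simps)
    then show ?thesis unfolding G_def using int_q by simp
  qed
  \<comment> \<open>The differences of \<open>\<gamma>\<^sub>k\<^sub>l = x\<^sup>2 \<integral> t\<^sup>k\<^sup>l\<^sup>-\<^sup>1 d\<mu>\<close>. Since \<open>\<gamma>\<^sub>0 = 1\<close> is not of this form, the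
    entries for \<open>k = 0\<close> are obtained by summing the recurrence over \<open>m\<close>.\<close>
  define E where "E m k = (if k = 0 then 1 - x\<^sup>2 / C * (\<Sum>i<m. G i (l - 1)) else x\<^sup>2 * G m (k * l - 1))" for m k
  obtain K :: "(nat \<Rightarrow> complex) set inner_space" and N V where
    K: "hilbert_space K" and N: "normal_operator K N" and V: "isometric_embedding ell2 K V"
    and NV: "\<And>f. f \<in> vecs ell2 \<Longrightarrow> N (V f) = V (?T f)"
    using sub unfolding subnormal_operator_def by blast
  interpret K: hilbert_space K by fact
  have T_closed: "(?T ^^ k) (basis_vec 0) \<in> vecs ell2" for k
    using bounded_operator_weighted_shift_power[OF \<beta>, of "l * k"] basis_vec_in_ell2
    by (auto simp: funpow_mult bounded_operator_def linear_map_def mult.commute)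
  have NV_pow: "(N ^^ k) (V (basis_vec 0)) = V ((?T ^^ k) (basis_vec 0))" for k
    by (induction k) (use NV T_closed in auto)
  have E_0: "complex_of_real (E 0 k) = vinner K ((N ^^ k) (V (basis_vec 0))) ((N ^^ k) (V (basis_vec 0)))"
    for k
  proof -
    have "vinner K ((N ^^ k) (V (basis_vec 0))) ((N ^^ k) (V (basis_vec 0)))
        = vinner ell2 ((?T ^^ k) (basis_vec 0)) ((?T ^^ k) (basis_vec 0))"
      using V T_closed unfolding NV_pow isometric_embedding_def by blast
    also have "\<dots> = of_real (moment ?\<beta> (k * l))"
      by (simp add: funpow_mult weighted_shift_power_basis_vec_0[OF \<beta>] ell2_inner_basis_vec
          moment_weight_prod mult.commute)
    also have "moment ?\<beta> (k * l) = E 0 k"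
      using l by (cases "k = 0") (simp_all add: E_def G_0 moment_back_step_integral)
    finally show ?thesis by simp
  qed
  have E_Suc: "E (Suc m) k = E m k - 1 / C * E m (Suc k)" for m k
  proof (cases "k = 0")
    case True
    then show ?thesis by (simp add: E_def algebra_simps)
  next
    case False
    have "Suc k * l - 1 = (k * l - 1) + l"
      using False l by (simp add: algebra_simps Suc_leI)
    then show ?thesis using False by (simp add: E_def G_Suc algebra_simps)
  qed
  have "V (basis_vec 0) \<in> vecs K"
    using V basis_vec_in_ell2 by (auto simp: isometric_embedding_def linear_map_def)
  then have E_nonneg: "0 \<le> E (2 * n) 0" for n
    using K.normal_even_differences_nonneg[OF N _ E_0 E_Suc] by blast
  \<comment> \<open>The quotient \<open>(1 - (1 - u)\<^sup>m) / t\<close> as a geometric sum, which also makes sense at \<open>t = 0\<close>.\<close>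
  define h where "h m t = (\<Sum>i<m. q i t * t ^ (l - 1)) / C" for m and t :: real
  have [measurable]: "h m \<in> borel_measurable borel" for m unfolding h_def by measurable
  have h_eq: "h m t = (1 - q m t) / t" if "t > 0" for m t
  proof -
    have "t ^ l / C * (\<Sum>i<m. q i t) = 1 - q m t"
      using one_diff_power_eq[of "1 - t ^ l / C" m] by (simp add: q_def)
    moreover have "t ^ l = t * t ^ (l - 1)" using l by (simp add: power_eq_if)
    ultimately show ?thesis
      using that C by (simp add: h_def sum_distrib_right[symmetric] field_simps)
  qed
  have int_h: "integrable \<mu> (h m)" for m unfolding h_def using int_q by simp
  have h_nonneg: "0 \<le> h m t" if "0 \<le> t" "t \<le> R" for m t
    unfolding h_def using q01[OF that] that C by (auto intro!: divide_nonneg_pos sum_nonneg)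
  have h_le: "(\<integral>\<^sup>+t. ennreal (h (2 * n) t) \<partial>\<mu>) \<le> ennreal (1 / x\<^sup>2)" for n
  proof -
    have "(\<integral>\<^sup>+t. ennreal (h (2 * n) t) \<partial>\<mu>) = ennreal (\<integral>t. h (2 * n) t \<partial>\<mu>)"
    proof (rule nn_integral_eq_integral[OF int_h])
      show "AE t in \<mu>. 0 \<le> h (2 * n) t" using AE_R by eventually_elim (use h_nonneg in auto)
    qed
    also have "(\<integral>t. h (2 * n) t \<partial>\<mu>) = (\<Sum>i<2 * n. G i (l - 1)) / C"
      unfolding h_def G_def using int_q by simp
    also have "\<dots> \<le> 1 / x\<^sup>2"
      using E_nonneg[of n] x_pos by (simp add: E_def field_simps)
    finally show ?thesis by (simp add: ennreal_leI)
  qed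
  have "(\<integral>\<^sup>+t. ennreal \<bar>1 / t\<bar> \<partial>\<mu>) \<le> (\<integral>\<^sup>+t. liminf (\<lambda>n. ennreal (h (2 * n) t)) \<partial>\<mu>)"
  proof (rule nn_integral_mono_AE, use AE_R in eventually_elim)
    case (elim t)
    show ?case
    proof (cases "t = 0")
      case False
      then have t: "t > 0" using elim by simp
      have "\<bar>1 - t ^ l / C\<bar> < 1" using u01[of t] t elim C by simp
      then have "(\<lambda>m. q m t) \<longlonglongrightarrow> 0" unfolding q_def by (intro LIMSEQ_power_zero) simp
      then have "(\<lambda>m. (1 - q m t) / t) \<longlonglongrightarrow> (1 - 0) / t"
        by (intro tendsto_intros) (use t in auto)
      then have "(\<lambda>m. h m t) \<longlonglongrightarrow> 1 / t" using t by (simp add: h_eq)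
      then have "(\<lambda>n. h (2 * n) t) \<longlonglongrightarrow> 1 / t"
        by (rule LIMSEQ_subseq_LIMSEQ[unfolded o_def]) (simp add: strict_mono_def)
      then have "liminf (\<lambda>n. ennreal (h (2 * n) t)) = ennreal (1 / t)"
        by (intro lim_imp_Liminf tendsto_ennrealI) auto
      then show ?thesis using t by simp
    qed simp
  qed
  also have "\<dots> \<le> liminf (\<lambda>n. \<integral>\<^sup>+t. ennreal (h (2 * n) t) \<partial>\<mu>)"
    by (intro nn_integral_liminf) measurable
  also have "\<dots> \<le> liminf (\<lambda>n. ennreal (1 / x\<^sup>2))"
    by (intro Liminf_mono always_eventually allI h_le)
  also have "\<dots> = ennreal (1 / x\<^sup>2)" by (simp add: Liminf_const)
  finally show ?thesis .
qed

text \<open>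
  The normal extension acts on \<open>L\<^sup>2\<close> of the following measure. The points \<open>((True, n), t)\<close> carry
  a bilateral shift by \<open>l\<close> in \<open>n\<close>, multiplied by \<open>t\<^sup>l\<^sup>/\<^sup>2\<close>; on the points
  \<open>((False, n), t)\<close> the normal operator is zero, and they contain the part of \<open>e\<^sub>0\<close> that it
  annihilates.
\<close>

definition extension_measure :: "((bool \<times> int) \<times> real) measure" where
  "extension_measure = count_space UNIV \<Otimes>\<^sub>M \<mu>"

definition index_shift :: "int \<Rightarrow> (bool \<times> int) \<times> real \<Rightarrow> (bool \<times> int) \<times> real" where
  "index_shift k p = ((fst (fst p), snd (fst p) + k), snd p)"

definition multiplier :: "nat \<Rightarrow> (bool \<times> int) \<times> real \<Rightarrow> complex" where
  "multiplier l p = (if fst (fst p) \<and> 0 \<le> snd p \<and> snd p \<le> R then of_real (sqrt (snd p) ^ l) else 0)"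

text \<open>
  The function \<open>x t\<^sup>(\<^sup>n\<^sup>-\<^sup>1\<^sup>)\<^sup>/\<^sup>2\<close> represents \<open>\<gamma>\<^sub>n\<^sup>1\<^sup>/\<^sup>2 e\<^sub>n\<close>, with \<open>\<gamma>\<^sub>n\<close> the moments of
  \<open>\<alpha>(x)\<close>: its squared norm in \<open>L\<^sup>2(\<mu>)\<close> is \<open>\<gamma>\<^sub>n\<close> for \<open>n \<ge> 1\<close>, and it falls short of
  \<open>\<gamma>\<^sub>0 = 1\<close> by \<open>defect\<close> for \<open>n = 0\<close>.
\<close>

definition defect :: real where
  "defect = 1 - x\<^sup>2 * (\<integral>t. 1 / t \<partial>\<mu>)"

definition half_monomial :: "nat \<Rightarrow> real \<Rightarrow> real" where
  "half_monomial n t = (if n = 0 then x / sqrt t else x * sqrt t ^ (n - 1))"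

definition embedding_coeff :: "bool \<times> int \<Rightarrow> real \<Rightarrow> real" where
  "embedding_coeff i t =
    (if fst i then if 0 \<le> snd i
       then half_monomial (nat (snd i)) t / weight_prod (back_step x \<alpha>) (nat (snd i)) else 0
     else if snd i = 0 then sqrt defect else 0)"

definition embedding_fun :: "(nat \<Rightarrow> complex) \<Rightarrow> (bool \<times> int) \<times> real \<Rightarrow> complex" where
  "embedding_fun f p = f (nat (snd (fst p))) * of_real (embedding_coeff (fst p) (snd p))"

lemma sigma_finite_count_space: "sigma_finite_measure (count_space (UNIV :: (bool \<times> int) set))"
  by (rule sigma_finite_measure_count_space_countable) simp

lemma pair_sigma_finite_extension: "pair_sigma_finite (count_space (UNIV :: (bool \<times> int) set)) \<mu>"
  by (intro pair_sigma_finite.intro sigma_finite_count_space sigma_finite_measure_axioms)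

lemma measurable_extension:
  assumes "\<And>i. (\<lambda>t. f (i, t)) \<in> borel \<rightarrow>\<^sub>M N"
  shows "f \<in> extension_measure \<rightarrow>\<^sub>M N"
  unfolding extension_measure_def
  by (rule measurable_pair_measure_countable1)
    (use assms in \<open>auto simp: measurable_cong_sets[OF sets_\<mu>]\<close>)

lemma AE_extension:
  assumes "AE t in \<mu>. P t"
  shows "AE p in extension_measure. P (snd p)"
proof -
  obtain N where N: "{t \<in> space \<mu>. \<not> P t} \<subseteq> N" "emeasure \<mu> N = 0" "N \<in> sets \<mu>"
    using assms by (rule AE_E)
  have "(UNIV :: (bool \<times> int) set) \<times> N \<in> null_sets extension_measure"
    using N emeasure_pair_measure_Times[of "UNIV :: (bool \<times> int) set" "count_space UNIV" N]
    by (auto simp: null_sets_def extension_measure_def)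
  then show ?thesis
    by (rule AE_I') (use N(1) in \<open>auto simp: extension_measure_def space_pair_measure\<close>)
qed

lemma measurable_index_shift [measurable]: "index_shift k \<in> extension_measure \<rightarrow>\<^sub>M extension_measure"
proof (rule measurable_extension)
  show "(\<lambda>t. index_shift k (i, t)) \<in> borel \<rightarrow>\<^sub>M extension_measure" for i
    unfolding index_shift_def extension_measure_def by simp
qed

lemma distr_index_shift: "distr extension_measure extension_measure (index_shift k) = extension_measure"
proof -
  let ?c = "count_space (UNIV :: (bool \<times> int) set)" and ?s = "\<lambda>i :: bool \<times> int. (fst i, snd i + k)"
  have bij: "bij_betw ?s UNIV UNIV"
    by (rule bij_betw_byWitness[of _ "\<lambda>i. (fst i, snd i - k)"]) auto
  have "distr ?c ?c ?s \<Otimes>\<^sub>M distr \<mu> \<mu> (\<lambda>t. t)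
      = distr (?c \<Otimes>\<^sub>M \<mu>) (?c \<Otimes>\<^sub>M \<mu>) (\<lambda>(i, t). (?s i, t))"
    by (rule pair_measure_distr) (auto simp: distr_id sigma_finite_measure_axioms)
  moreover have "(\<lambda>(i, t). (?s i, t)) = index_shift k" by (auto simp: index_shift_def)
  ultimately show ?thesis
    by (simp add: distr_id distr_bij_count_space[OF bij] extension_measure_def)
qed

lemma measurable_multiplier [measurable]: "multiplier l \<in> borel_measurable extension_measure"
proof (rule measurable_extension)
  show "(\<lambda>t. multiplier l (i, t)) \<in> borel_measurable borel" for i
    unfolding multiplier_def fst_conv snd_conv by measurable
qed

lemma normal_operator_extension:
  "normal_operator (L2_space extension_measure)
    (weighted_composition extension_measure (multiplier l) (index_shift (- int l)))"
proof (rule normal_operator_weighted_composition[where t = "index_shift (int l)" and C = "sqrt R ^ l"])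
  show "cmod (multiplier l p) \<le> sqrt R ^ l" for p
    using R_pos by (auto simp: multiplier_def norm_power intro!: power_mono)
qed (auto intro: distr_index_shift simp: index_shift_def multiplier_def)

text \<open>
  The last assumption excludes the case \<open>l = 1\<close>, \<open>t = 0\<close>, in which for \<open>n = 0\<close> the left side is 0
  and the right side is \<open>x\<close>.
\<close>

lemma half_monomial_shift:
  assumes "0 \<le> t" "l \<ge> 1" "l \<ge> 2 \<or> t \<noteq> 0"
  shows "sqrt t ^ l * half_monomial n t = half_monomial (n + l) t"
proof (cases n)
  case 0
  have "sqrt t ^ l = sqrt t * sqrt t ^ (l - 1)" using assms(2) by (simp add: power_eq_if)
  then show ?thesis using assms 0 by (auto simp: half_monomial_def power_0_left)
next
  case (Suc m)
  then show ?thesis by (simp add: half_monomial_def power_add)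
qed

lemma embedding_fun_intertwines:
  assumes "0 \<le> t" "t \<le> R" "l \<ge> 1" "l \<ge> 2 \<or> t \<noteq> 0"
  shows "multiplier l (i, t) * embedding_fun f (index_shift (- int l) (i, t))
    = embedding_fun ((weighted_shift (back_step x \<alpha>) ^^ l) f) (i, t)"
proof -
  let ?\<beta> = "back_step x \<alpha>"
  note \<beta> = weight_sequence_back_step[OF weights x_pos]
  obtain b n where i: "i = (b, n)" by (cases i)
  show ?thesis
  proof (cases "b \<and> int l \<le> n")
    case False
    then show ?thesis
      using assms by (auto simp: i multiplier_def embedding_fun_def index_shift_def embedding_coeff_def
          weighted_shift_power[OF \<beta>])
  next
    case True
    define k where "k = nat (n - int l)"
    have n: "n = int (k + l)" using True by (simp add: k_def)
    have "embedding_fun ((weighted_shift ?\<beta> ^^ l) f) (i, t)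
        = f k * of_real (half_monomial (k + l) t / weight_prod ?\<beta> k)"
      using True weight_prod_pos[OF \<beta>, of "k + l"]
      by (simp add: i n embedding_fun_def embedding_coeff_def weighted_shift_power[OF \<beta>] nat_add_distrib)
    also have "half_monomial (k + l) t = sqrt t ^ l * half_monomial k t"
      using half_monomial_shift[OF assms(1,3,4)] by simp
    also have "f k * of_real (sqrt t ^ l * half_monomial k t / weight_prod ?\<beta> k)
        = multiplier l (i, t) * embedding_fun f (index_shift (- int l) (i, t))"
      using True assms by (simp add: i n embedding_fun_def embedding_coeff_def multiplier_def index_shift_def)
    finally show ?thesis by simp
  qed
qed

lemma borel_measurable_embedding_coeff [measurable]: "embedding_coeff i \<in> borel_measurable borel"
proof -
  have "half_monomial n \<in> borel_measurable borel" for n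
    unfolding half_monomial_def by (cases "n = 0") simp_all
  then show ?thesis unfolding embedding_coeff_def by simp
qed

lemma borel_measurable_embedding_fun [measurable]:
  "embedding_fun f \<in> borel_measurable extension_measure"
  by (rule measurable_extension) (simp add: embedding_fun_def)

context
  assumes integral_le: "(\<integral>\<^sup>+t. ennreal \<bar>1 / t\<bar> \<partial>\<mu>) \<le> ennreal (1 / x\<^sup>2)"
begin

lemma integrable_inverse: "integrable \<mu> (\<lambda>t. 1 / t)"
proof (rule integrableI_bounded)
  show "(\<lambda>t. 1 / t) \<in> borel_measurable \<mu>" by measurable
  show "(\<integral>\<^sup>+t. ennreal (norm (1 / t)) \<partial>\<mu>) < \<infinity>"
    using integral_le le_less_trans[OF _ ennreal_less_top] by simp
qed

lemma defect_nonneg: "0 \<le> defect"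
proof -
  have "ennreal (\<integral>t. 1 / t \<partial>\<mu>) \<le> (\<integral>\<^sup>+t. ennreal \<bar>1 / t\<bar> \<partial>\<mu>)"
    using integral_norm_bound_ennreal[OF integrable_inverse]
    by (smt (verit) ennreal_leI order_trans real_norm_def nn_integral_cong)
  also have "\<dots> \<le> ennreal (1 / x\<^sup>2)" by (rule integral_le)
  finally have "(\<integral>t. 1 / t \<partial>\<mu>) \<le> 1 / x\<^sup>2" by (simp add: ennreal_le_iff)
  then show ?thesis using x_pos by (simp add: defect_def field_simps)
qed

lemma embedding_coeff_norm:
  shows "integrable \<mu> (\<lambda>t. (embedding_coeff i t)\<^sup>2)"
    and "(\<integral>t. (embedding_coeff i t)\<^sup>2 \<partial>\<mu>) =
      (if fst i \<and> 0 \<le> snd i then 1 else 0) +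
      (if i = (True, 0) then - defect else if i = (False, 0) then defect else 0)"
proof -
  let ?\<beta> = "back_step x \<alpha>"
  note \<beta> = weight_sequence_back_step[OF weights x_pos]
  obtain b n where i: "i = (b, n)" by (cases i)
  consider "\<not> b" | "b" "n < 0" | "b" "n = 0" | "b" "n > 0" by linarith
  then have "integrable \<mu> (\<lambda>t. (embedding_coeff i t)\<^sup>2) \<and> (\<integral>t. (embedding_coeff i t)\<^sup>2 \<partial>\<mu>) =
      (if fst i \<and> 0 \<le> snd i then 1 else 0) +
      (if i = (True, 0) then - defect else if i = (False, 0) then defect else 0)"
  proof cases
    case 1
    then show ?thesis using defect_nonneg by (auto simp: i embedding_coeff_def prob_space)
  next
    case 2
    then show ?thesis by (simp add: i embedding_coeff_def)
  next
    case 3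
    have ae: "AE t in \<mu>. (embedding_coeff i t)\<^sup>2 = x\<^sup>2 * (1 / t)"
      using AE_R by eventually_elim
        (use 3 in \<open>simp add: i embedding_coeff_def half_monomial_def weight_prod_def power_divide\<close>)
    have "(\<integral>t. (embedding_coeff i t)\<^sup>2 \<partial>\<mu>) = (\<integral>t. x\<^sup>2 * (1 / t) \<partial>\<mu>)"
      by (rule integral_cong_AE) (use ae in auto)
    moreover have "integrable \<mu> (\<lambda>t. (embedding_coeff i t)\<^sup>2) = integrable \<mu> (\<lambda>t. x\<^sup>2 * (1 / t))"
      by (rule integrable_cong_AE) (use ae in auto)
    moreover have "integrable \<mu> (\<lambda>t. x\<^sup>2 * (1 / t))"
      using integrable_inverse by (rule integrable_mult_right)
    moreover have "(\<integral>t. x\<^sup>2 * (1 / t) \<partial>\<mu>) = 1 - defect"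
      unfolding integral_mult_right_zero defect_def by simp
    ultimately show ?thesis using 3 by (simp only: i) simp
  next
    case 4
    define m where "m = nat n"
    have m: "m \<ge> 1" "nat n = m" using 4 by (auto simp: m_def)
    have ae: "AE t in \<mu>. (embedding_coeff i t)\<^sup>2 = x\<^sup>2 * t ^ (m - 1) / moment ?\<beta> m"
      using AE_R
    proof eventually_elim
      case (elim t)
      have "(sqrt t ^ (m - 1))\<^sup>2 = t ^ (m - 1)"
        using elim by (simp add: power_mult[symmetric] mult.commute[of _ 2])
          (simp add: power_mult)
      then show ?case
        using 4 m by (simp add: i embedding_coeff_def half_monomial_def power_divide
            power_mult_distrib moment_weight_prod)
    qed
    have int: "integrable \<mu> (\<lambda>t. t ^ (m - 1))"
      by (rule integrable_bounded[where B = "R ^ (m - 1)"]) (auto intro: power_mono)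
    have "(\<integral>t. (embedding_coeff i t)\<^sup>2 \<partial>\<mu>) = (\<integral>t. x\<^sup>2 * t ^ (m - 1) / moment ?\<beta> m \<partial>\<mu>)"
      by (rule integral_cong_AE) (use ae in auto)
    also have "\<dots> = x\<^sup>2 * (\<integral>t. t ^ (m - 1) \<partial>\<mu>) / moment ?\<beta> m" using int by simp
    also have "\<dots> = moment ?\<beta> m / moment ?\<beta> m"
      by (simp only: moment_back_step_integral[OF m(1)])
    also have "\<dots> = 1"
      using weight_prod_pos[OF \<beta>, of m] by (simp add: moment_weight_prod)
    finally have "(\<integral>t. (embedding_coeff i t)\<^sup>2 \<partial>\<mu>) = 1" .
    moreover have "integrable \<mu> (\<lambda>t. (embedding_coeff i t)\<^sup>2)
        = integrable \<mu> (\<lambda>t. x\<^sup>2 * t ^ (m - 1) / moment ?\<beta> m)"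
      by (rule integrable_cong_AE) (use ae in auto)
    ultimately show ?thesis using 4 int by (simp add: i)
  qed
  then show "integrable \<mu> (\<lambda>t. (embedding_coeff i t)\<^sup>2)"
    and "(\<integral>t. (embedding_coeff i t)\<^sup>2 \<partial>\<mu>) =
      (if fst i \<and> 0 \<le> snd i then 1 else 0) +
      (if i = (True, 0) then - defect else if i = (False, 0) then defect else 0)" by auto
qed

text \<open>
  The mass \<open>defect\<close> that the coordinate \<open>(True, 0)\<close> lacks is located at \<open>(False, 0)\<close>, and both
  coordinates multiply \<open>a 0\<close>.
\<close>

lemma embedding_coeff_sum:
  fixes a :: "nat \<Rightarrow> complex"
  assumes "summable (\<lambda>n. norm (a n))"
  defines "F \<equiv> \<lambda>i. a (nat (snd i)) * of_real (\<integral>t. (embedding_coeff i t)\<^sup>2 \<partial>\<mu>)"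
  shows "integrable (count_space UNIV) F" "(\<integral>i. F i \<partial>count_space UNIV) = (\<Sum>n. a n)"
proof -
  define \<iota> where "\<iota> n = (True, int n)" for n
  have inj: "inj \<iota>" by (auto simp: \<iota>_def inj_on_def)
  \<comment> \<open>\<open>F\<^sub>1\<close> is the value without a defect; \<open>F\<^sub>2\<close> is the correction at two points, with sum 0.\<close>
  define F\<^sub>1 where "F\<^sub>1 i = (if fst i \<and> 0 \<le> snd i then a (nat (snd i)) else 0)" for i :: "bool \<times> int"
  define F\<^sub>2 where "F\<^sub>2 i = a 0 * of_real (if i = (True, 0) then - defect else if i = (False, 0) then defect else 0)"
    for i :: "bool \<times> int"
  have F: "F i = F\<^sub>1 i + F\<^sub>2 i" for i
    unfolding F_def F\<^sub>1_def F\<^sub>2_def embedding_coeff_norm(2)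
    by (cases i) (auto simp: algebra_simps)
  have range: "range \<iota> = {i. fst i \<and> 0 \<le> snd i}"
  proof (intro equalityI subsetI)
    fix i :: "bool \<times> int" assume "i \<in> {i. fst i \<and> 0 \<le> snd i}"
    then have "i = \<iota> (nat (snd i))" by (simp add: \<iota>_def prod_eq_iff)
    then show "i \<in> range \<iota>" by (rule range_eqI)
  qed (auto simp: \<iota>_def)
  have a: "Infinite_Set_Sum.abs_summable_on a UNIV"
    using assms(1) by (simp add: abs_summable_on_nat_iff')
  have "Infinite_Set_Sum.abs_summable_on F\<^sub>1 UNIV \<longleftrightarrow> Infinite_Set_Sum.abs_summable_on F\<^sub>1 (range \<iota>)"
    by (rule abs_summable_on_cong_neutral) (auto simp: range F\<^sub>1_def)
  also have "\<dots> \<longleftrightarrow> Infinite_Set_Sum.abs_summable_on (\<lambda>n. F\<^sub>1 (\<iota> n)) UNIV"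
    using abs_summable_on_reindex_iff[OF inj] by auto
  also have "(\<lambda>n. F\<^sub>1 (\<iota> n)) = a" by (auto simp: F\<^sub>1_def \<iota>_def)
  finally have S\<^sub>1: "Infinite_Set_Sum.abs_summable_on F\<^sub>1 UNIV" using a by simp
  have "Infinite_Set_Sum.abs_summable_on F\<^sub>2 UNIV \<longleftrightarrow> Infinite_Set_Sum.abs_summable_on F\<^sub>2 {(True, 0), (False, 0)}"
    by (rule abs_summable_on_cong_neutral) (auto simp: F\<^sub>2_def)
  then have S\<^sub>2: "Infinite_Set_Sum.abs_summable_on F\<^sub>2 UNIV" by simp
  show "integrable (count_space UNIV) F"
    using abs_summable_on_add[OF S\<^sub>1 S\<^sub>2] by (simp add: Infinite_Set_Sum.abs_summable_on_def F[abs_def])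
  have "infsetsum F\<^sub>1 UNIV = infsetsum F\<^sub>1 (range \<iota>)"
    by (rule infsetsum_cong_neutral) (auto simp: range F\<^sub>1_def)
  also have "\<dots> = infsetsum (\<lambda>n. F\<^sub>1 (\<iota> n)) UNIV" by (rule infsetsum_reindex[OF inj])
  also have "\<dots> = (\<Sum>n. a n)"
    using infsetsum_nat'[OF a] by (simp add: F\<^sub>1_def \<iota>_def)
  finally have V\<^sub>1: "infsetsum F\<^sub>1 UNIV = (\<Sum>n. a n)" .
  have "infsetsum F\<^sub>2 UNIV = infsetsum F\<^sub>2 {(True, 0), (False, 0)}"
    by (rule infsetsum_cong_neutral) (auto simp: F\<^sub>2_def)
  also have "\<dots> = 0" by (simp add: F\<^sub>2_def)
  finally have V\<^sub>2: "infsetsum F\<^sub>2 UNIV = 0" .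
  have "infsetsum F UNIV = (\<Sum>n. a n)"
    unfolding F[abs_def] using infsetsum_add[OF S\<^sub>1 S\<^sub>2] V\<^sub>1 V\<^sub>2 by simp
  then show "(\<integral>i. F i \<partial>count_space UNIV) = (\<Sum>n. a n)" by (simp add: infsetsum_def)
qed

lemma embedding_fun_square_integrable:
  assumes "f \<in> vecs ell2"
  shows "square_integrable extension_measure (embedding_fun f)"
proof -
  interpret P: pair_sigma_finite "count_space (UNIV :: (bool \<times> int) set)" \<mu>
    by (rule pair_sigma_finite_extension)
  let ?h = "\<lambda>p. (cmod (embedding_fun f p))\<^sup>2"
  have h: "?h (i, t) = (cmod (f (nat (snd i))))\<^sup>2 * (embedding_coeff i t)\<^sup>2" for i t
    by (simp add: embedding_fun_def norm_mult power_mult_distrib)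
  have [measurable]: "?h \<in> borel_measurable (count_space UNIV \<Otimes>\<^sub>M \<mu>)"
    using borel_measurable_embedding_fun[of f] unfolding extension_measure_def by measurable
  have "integrable (count_space UNIV \<Otimes>\<^sub>M \<mu>) ?h"
  proof (rule P.Fubini_integrable)
    have "integrable (count_space UNIV)
        (\<lambda>i. complex_of_real ((cmod (f (nat (snd i))))\<^sup>2) * of_real (\<integral>t. (embedding_coeff i t)\<^sup>2 \<partial>\<mu>))"
      using assms by (intro embedding_coeff_sum) (simp add: ell2_def norm_power)
    then have "integrable (count_space UNIV)
        (\<lambda>i. Re (complex_of_real ((cmod (f (nat (snd i))))\<^sup>2) * of_real (\<integral>t. (embedding_coeff i t)\<^sup>2 \<partial>\<mu>)))"
      by (rule integrable_Re)
    then show "integrable (count_space UNIV) (\<lambda>i. \<integral>t. norm (?h (i, t)) \<partial>\<mu>)"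
      by (simp add: h)
    show "AE i in count_space UNIV. integrable \<mu> (\<lambda>t. ?h (i, t))"
      by (simp add: h embedding_coeff_norm(1))
  qed measurable
  then show ?thesis
    by (simp add: square_integrable_def) (simp add: extension_measure_def)
qed

lemma embedding_fun_inner:
  assumes f: "f \<in> vecs ell2" and g: "g \<in> vecs ell2"
  shows "vinner (L2_space extension_measure) (embedding_fun f) (embedding_fun g) = vinner ell2 f g"
proof -
  interpret P: pair_sigma_finite "count_space (UNIV :: (bool \<times> int) set)" \<mu>
    by (rule pair_sigma_finite_extension)
  let ?a = "\<lambda>n. f n * cnj (g n)"
  have "summable (\<lambda>n. (cmod (f n))\<^sup>2 + (cmod (g n))\<^sup>2)"
    using f g by (intro summable_add) (simp_all add: ell2_def)
  then have "summable (\<lambda>n. norm (?a n))"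
  proof (rule summable_comparison_test'[where N = 0])
    show "norm (norm (?a n)) \<le> (cmod (f n))\<^sup>2 + (cmod (g n))\<^sup>2" for n
      using sum_squares_bound[of "cmod (f n)" "cmod (g n)"] norm_ge_zero[of "?a n"]
      unfolding norm_mult complex_mod_cnj real_norm_def abs_mult abs_norm_cancel by linarith
  qed
  note sum = embedding_coeff_sum[OF this]
  have eq: "embedding_fun f (i, t) * cnj (embedding_fun g (i, t))
      = ?a (nat (snd i)) * of_real ((embedding_coeff i t)\<^sup>2)" for i t
    by (simp add: embedding_fun_def power2_eq_square)
  have "vinner (L2_space extension_measure) (embedding_fun f) (embedding_fun g)
      = (\<integral>i. \<integral>t. embedding_fun f (i, t) * cnj (embedding_fun g (i, t)) \<partial>\<mu> \<partial>count_space UNIV)"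
    using integrable_L2_product[OF embedding_fun_square_integrable[OF f] embedding_fun_square_integrable[OF g]]
    unfolding L2_space_def inner_space.simps extension_measure_def
    by (rule P.integral_fst'[symmetric])
  also have "\<dots> = (\<integral>i. ?a (nat (snd i)) * of_real (\<integral>t. (embedding_coeff i t)\<^sup>2 \<partial>\<mu>) \<partial>count_space UNIV)"
    unfolding eq integral_mult_right_zero integral_complex_of_real ..
  also have "\<dots> = vinner ell2 f g" using sum(2) by (simp add: ell2_def)
  finally show ?thesis .
qed

lemma isometric_embedding_extension:
  "isometric_embedding ell2 (L2_space extension_measure) (\<lambda>f. ae_rep extension_measure (embedding_fun f))"
  (is "isometric_embedding _ ?K ?V")
  unfolding isometric_embedding_def linear_map_def
proof (intro conjI ballI allI)
  note ae = AE_ae_rep[OF borel_measurable_embedding_fun]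
  have V: "?V f \<in> vecs ?K" if "f \<in> vecs ell2" for f
    using embedding_fun_square_integrable[OF that] by (rule ae_rep_in_L2)
  fix f assume f: "f \<in> vecs ell2"
  show "?V f \<in> vecs ?K" using f by (rule V)
  show "?V (vscale ell2 c f) = vscale ?K c (?V f)" for c
  proof -
    have "?V (vscale ell2 c f) = ae_rep extension_measure (\<lambda>p. c * ?V f p)"
    proof (rule ae_rep_cong, use ae[of f] in eventually_elim)
      case (elim p)
      then show ?case by (simp add: embedding_fun_def ell2_def)
    qed
    then show ?thesis by (simp add: L2_space_simps)
  qed
  fix g assume g: "g \<in> vecs ell2"
  show "?V (vplus ell2 f g) = vplus ?K (?V f) (?V g)"
  proof -
    have "?V (vplus ell2 f g) = ae_rep extension_measure (\<lambda>p. ?V f p + ?V g p)"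
    proof (rule ae_rep_cong, use ae[of f] ae[of g] in eventually_elim)
      case (elim p)
      then show ?case by (simp add: embedding_fun_def ell2_def distrib_right)
    qed
    then show ?thesis by (simp add: L2_space_simps)
  qed
  have "vinner ?K (?V f) (?V g) = vinner ?K (embedding_fun f) (embedding_fun g)"
    using V[OF f] V[OF g] by (intro L2_inner_cong ae) (auto dest: L2_space_vecs(2))
  then show "vinner ?K (?V f) (?V g) = vinner ell2 f g"
    using embedding_fun_inner[OF f g] by simp
qed

text \<open>A function on the points \<open>((b, n), t)\<close> is coded as its graph, each point being a sequence.\<close>

definition graph_code :: "((bool \<times> int) \<times> real \<Rightarrow> complex) \<Rightarrow> (nat \<Rightarrow> complex) set" where
  "graph_code F = range (\<lambda>((b, n), t) k. if k = 0 then of_bool b else if k = 1 then of_int n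
     else if k = 2 then of_real t else F ((b, n), t))"

lemma inj_graph_code: "inj graph_code"
proof (rule injI, rule ext)
  fix F G and p :: "(bool \<times> int) \<times> real"
  assume eq: "graph_code F = graph_code G"
  obtain b n t where p: "p = ((b, n), t)" by (metis prod.exhaust)
  let ?s = "\<lambda>k::nat. if k = 0 then of_bool b else if k = 1 then of_int n
     else if k = 2 then of_real t else F ((b, n), t)"
  have "?s \<in> graph_code F" unfolding graph_code_def by (rule range_eqI[of _ _ p]) (simp add: p)
  then obtain b' n' t' where *: "?s = (\<lambda>k::nat. if k = 0 then of_bool b' else if k = 1 then of_int n'
     else if k = 2 then of_real t' else G ((b', n'), t'))"
    unfolding eq by (auto simp: graph_code_def)
  show "F p = G p"
    using fun_cong[OF *, of 0] fun_cong[OF *, of 1] fun_cong[OF *, of 2] fun_cong[OF *, of 3]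
    by (cases b; cases b') (simp_all add: p)
qed

lemma integral_le_imp_subnormal_power:
  assumes l: "l \<ge> 1" and no_atom: "l \<ge> 2 \<or> (AE t in \<mu>. t \<noteq> 0)"
  shows "subnormal_operator ell2 (weighted_shift (back_step x \<alpha>) ^^ l)"
proof (rule subnormal_operatorI[OF inj_graph_code])
  let ?M = extension_measure and ?T = "weighted_shift (back_step x \<alpha>) ^^ l"
  let ?s = "index_shift (- int l)"
  let ?N = "weighted_composition ?M (multiplier l) ?s"
  note \<beta> = weight_sequence_back_step[OF weights x_pos]
  note ae = AE_ae_rep[OF borel_measurable_embedding_fun]
  show "bounded_operator ell2 ?T" using \<beta> by (rule bounded_operator_weighted_shift_power)
  show "hilbert_space (L2_space ?M)" by (rule hilbert_space_L2)
  show "normal_operator (L2_space ?M) ?N" by (rule normal_operator_extension)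
  show "isometric_embedding ell2 (L2_space ?M) (\<lambda>f. ae_rep ?M (embedding_fun f))"
    by (rule isometric_embedding_extension)
  fix f assume f: "f \<in> vecs ell2"
  have t: "AE p in ?M. 0 \<le> snd p \<and> snd p \<le> R \<and> (l \<ge> 2 \<or> snd p \<noteq> 0)"
  proof (rule AE_extension)
    show "AE t in \<mu>. 0 \<le> t \<and> t \<le> R \<and> (l \<ge> 2 \<or> t \<noteq> 0)"
      using AE_R no_atom by auto
  qed
  have shifted: "AE p in ?M. ae_rep ?M (embedding_fun f) (?s p) = embedding_fun f (?s p)"
    by (rule AE_measure_preserving[OF measurable_index_shift distr_index_shift ae])
  show "?N (ae_rep ?M (embedding_fun f)) = ae_rep ?M (embedding_fun (?T f))"
    unfolding weighted_composition_def
  proof (rule ae_rep_cong, use t shifted in eventually_elim)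
    case (elim p)
    then show ?case
      using embedding_fun_intertwines[of "snd p" l "fst p" f] l by simp
  qed
qed

end

end

text \<open>
  The inverse square root of 0 is \<open>0 powr (- 1 / 2) = 0\<close> here and not \<open>\<infinity>\<close>, whence \<open>a \<noteq> 0\<close>.
\<close>

lemma le_inverse_sqrt_iff:
  assumes "0 < x" "a \<noteq> 0"
  shows "x \<le> inverse_sqrt a \<longleftrightarrow> a \<le> ennreal (1 / x\<^sup>2)"
proof (cases a)
  case (real r)
  then have r: "r > 0" using assms(2) by (cases "r = 0") auto
  have "x \<le> inverse_sqrt a \<longleftrightarrow> x \<le> 1 / sqrt r"
    using real r by (simp add: inverse_sqrt_def powr_minus_divide powr_half_sqrt)
  also have "\<dots> \<longleftrightarrow> sqrt r \<le> 1 / x" using r assms(1) by (simp add: field_simps)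
  also have "\<dots> \<longleftrightarrow> r \<le> (1 / x)\<^sup>2"
    using assms(1) r by (metis real_le_lsqrt real_sqrt_le_iff real_sqrt_unique less_imp_le divide_nonneg_nonneg zero_le_one)
  finally show ?thesis using real by (simp add: power_divide ennreal_le_iff)
next
  case top
  then show ?thesis using assms(1) by (simp add: inverse_sqrt_def top_unique)
qed

lemma subnormal_power_back_step_iff:
  assumes weights: "weight_sequence \<alpha>" and berger: "berger_measure \<alpha> \<mu>" and x: "x > 0"
    and l: "l \<ge> 1" and no_atom: "l \<ge> 2 \<or> (AE t in \<mu>. t \<noteq> 0)"
  shows "subnormal_operator ell2 (weighted_shift (back_step x \<alpha>) ^^ l) \<longleftrightarrow>
    x \<le> inverse_sqrt (L1_norm_inverse \<mu>)"
proof -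
  \<comment> \<open>The summand 1 only serves to make \<open>R\<close> positive.\<close>
  define R where "R = (operator_norm ell2 (weighted_shift \<alpha>))\<^sup>2 + 1"
  interpret prob_space \<mu> using berger by (simp add: berger_measure_def)
  have sets: "sets \<mu> = sets borel" using berger by (simp add: berger_measure_def)
  interpret shift_moment_measure \<mu> \<alpha> R x
  proof
    show "sets \<mu> = sets borel" by fact
    have "measure_support \<mu> \<subseteq> {0..R}" using berger by (auto simp: berger_measure_def R_def)
    then show "AE t in \<mu>. 0 \<le> t \<and> t \<le> R"
      using AE_measure_support[OF sets] by (auto elim!: eventually_mono)
    show "0 < R" by (simp add: R_def add_nonneg_pos)
    show "moment \<alpha> n = (\<integral>t. t ^ n \<partial>\<mu>)" for n using berger by (simp add: berger_measure_def)
  qed fact+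
  have "L1_norm_inverse \<mu> \<noteq> 0"
  proof
    assume "L1_norm_inverse \<mu> = 0"
    then have "AE t in \<mu>. ennreal \<bar>1 / t\<bar> = 0"
      unfolding L1_norm_inverse_def by (subst (asm) nn_integral_0_iff_AE) auto
    then have "AE t in \<mu>. t ^ 1 = 0" by eventually_elim (simp add: ennreal_eq_0_iff)
    then have "(\<integral>t. t ^ 1 \<partial>\<mu>) = (\<integral>t. 0 \<partial>\<mu>)" by (intro integral_cong_AE) auto
    then show False
      using moment_eq[of 1] weight_prod_pos[OF weights, of 1] by (simp add: moment_weight_prod)
  qed
  then have "x \<le> inverse_sqrt (L1_norm_inverse \<mu>) \<longleftrightarrow> L1_norm_inverse \<mu> \<le> ennreal (1 / x\<^sup>2)"
    using x by (rule le_inverse_sqrt_iff[rotated])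
  then show ?thesis
    using subnormal_power_imp_integral_le[OF l] integral_le_imp_subnormal_power[OF _ l no_atom]
    unfolding L1_norm_inverse_def by blast
qed

text \<open>The atom at 0 does not contribute because \<open>1 / 0 = 0\<close>.\<close>

lemma L1_norm_inverse_remove_atom:
  assumes sets: "sets \<mu> = sets borel" "sets \<nu> = sets borel"
    and split: "\<And>A. A \<in> sets borel \<Longrightarrow>
      emeasure \<mu> A = emeasure \<nu> A + ennreal \<rho> * emeasure (return borel 0) A"
    and \<nu>_0: "emeasure \<nu> {0} = 0"
  shows "L1_norm_inverse \<nu> = L1_norm_inverse \<mu>"
proof -
  have [measurable_cong]: "sets \<mu> = sets borel" by fact
  have "\<nu> = density \<mu> (indicator (- {0}))"
  proof (rule measure_eqI)
    fix A assume "A \<in> sets \<nu>"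
    then have A: "A \<in> sets borel" using sets by simp
    then have A': "A - {0} \<in> sets borel" by auto
    have "emeasure (density \<mu> (indicator (- {0}))) A = (\<integral>\<^sup>+t. indicator (- {0}) t * indicator A t \<partial>\<mu>)"
      using A sets by (intro emeasure_density) auto
    also have "\<dots> = (\<integral>\<^sup>+t. indicator (A - {0}) t \<partial>\<mu>)"
      by (intro nn_integral_cong) (auto split: split_indicator)
    also have "\<dots> = emeasure \<mu> (A - {0})" using A' sets by (intro nn_integral_indicator) simp
    also have "\<dots> = emeasure \<nu> (A - {0})" using split[OF A'] A' by simp
    also have "\<dots> = emeasure \<nu> A"
      using \<nu>_0 sets A by (intro emeasure_Diff_null_set) (auto simp: null_sets_def)
    finally show "emeasure \<nu> A = emeasure (density \<mu> (indicator (- {0}))) A" by simp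
  qed (simp add: sets)
  then have "L1_norm_inverse \<nu> = (\<integral>\<^sup>+t. indicator (- {0}) t * ennreal \<bar>1 / t\<bar> \<partial>\<mu>)"
    unfolding L1_norm_inverse_def by (simp add: nn_integral_density)
  also have "\<dots> = L1_norm_inverse \<mu>"
    unfolding L1_norm_inverse_def by (rule nn_integral_cong) (auto split: split_indicator)
  finally show ?thesis .
qed


theorem theorem3p3:
  fixes \<alpha> :: "nat \<Rightarrow> real" and \<mu> \<nu> :: "real measure" and \<rho> x :: real and l :: nat
  assumes "weight_sequence \<alpha>"
    and "subnormal_operator ell2 (weighted_shift \<alpha>)"
    and "berger_measure \<alpha> \<mu>"
    and "sets \<nu> = sets borel"
    and "\<rho> \<ge> 0"
    and "\<And>A. A \<in> sets borel \<Longrightarrow>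
           emeasure \<mu> A = emeasure \<nu> A + ennreal \<rho> * emeasure (return borel 0) A"
    and "emeasure \<nu> {0} = 0"
    and "l \<ge> 1"
    and "x > 0"
  shows "(l \<ge> 2 \<or> \<rho> = 0 \<longrightarrow>
           (subnormal_operator ell2 (weighted_shift (back_step x \<alpha>) ^^ l) \<longleftrightarrow>
            x \<le> inverse_sqrt (L1_norm_inverse \<nu>))) \<and>
         (\<rho> = 0 \<longrightarrow>
           (subnormal_operator ell2 (weighted_shift (back_step x \<alpha>) ^^ l) \<longleftrightarrow>
            subnormal_operator ell2 (weighted_shift (back_step x \<alpha>))))"
proof -
  have sets: "sets \<mu> = sets borel" using assms(3) by (simp add: berger_measure_def)
  have L1: "L1_norm_inverse \<nu> = L1_norm_inverse \<mu>"
    using sets assms(4,6,7) by (rule L1_norm_inverse_remove_atom)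
  have no_atom: "AE t in \<mu>. t \<noteq> 0" if "\<rho> = 0"
  proof (rule AE_I')
    show "{0} \<in> null_sets \<mu>" using assms(6)[of "{0}"] assms(7) that sets by (simp add: null_sets_def)
  qed auto
  have iff: "subnormal_operator ell2 (weighted_shift (back_step x \<alpha>) ^^ k) \<longleftrightarrow>
      x \<le> inverse_sqrt (L1_norm_inverse \<nu>)" if "k \<ge> 1" "k \<ge> 2 \<or> \<rho> = 0" for k
    unfolding L1 using that no_atom assms(1,3,9) by (intro subnormal_power_back_step_iff) auto
  show ?thesis using iff[of l] iff[of 1] assms(8) by simp
qed

end
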